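(* Let $\Gamma$ be a finitely generated profinite group, and let $\Gamma(i)_{i\in\mathbb N}$ be a decreasing chain of open normal subgroups of $\Gamma$ with trivial intersection. Let $n\ge 2$ be an integer. Let $\lambda_\Gamma$ and $\lambda_{\Gamma^{2n}}$ be the normalized Haar measures on $\Gamma$ and $\Gamma^{2n}$. Let $\Phi_{\Gamma,n}:\Gamma^{2n}\to\Gamma$ be the map $\Phi_{\Gamma,n}(x_1,y_1,\ldots,x_n,y_n)=[x_1,y_1]\cdots[x_n,y_n]$. The following are equivalent: 1. The measure $(\Phi_{\Gamma,n})_*\lambda_{\Gamma^{2n}}$ has a continuous density with respect to $\lambda_\Gamma$. 2. There is a constant $C$ such that $\lambda_{\Gamma^{2n}}\left(\Phi_{\Gamma,n}^{-1}(\Gamma(i))\right)\le C\cdot\lambda_\Gamma(\Gamma(i))$ for all $i$. 3. The series $\sum_{\chi\in\mathrm{Irr}\,\Gamma}\chi(1)^{2-2n}$ converges. If these conditions hold, then the density of $(\Phi_{\Gamma,n})_*\lambda_{\Gamma^{2n}}$ with respect to $\lambda_\Gamma$ is given by the function $g\mapsto\sum_{\chi\in\mathrm{Irr}\,\Gamma}\frac{\chi(g)}{\chi(1)^{2n-1}}$.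
   Context: $[x,y]=xyx^{-1}y^{-1}$. $\mathrm{Irr}\,\Gamma$ is the set of characters of continuous irreducible complex representations of $\Gamma$ (all finite-dimensional). The normalized Haar measure has total mass $1$. For a measurable map $f$ and a measure $m$, the push forward is $f_*m(A)=m(f^{-1}(A))$. *)

theory Defs
  imports
    "HOL-Probability.Probability"
    "HOL-Algebra.Algebra"
    "Jordan_Normal_Form.VS_Connect"
begin

locale topological_group = group G for G (structure) +
  fixes T :: "'a topology"
  assumes topspace_eq [simp]: "topspace T = carrier G"
    and continuous_mult: "continuous_map (prod_topology T T) T (\<lambda>(x, y). x \<otimes> y)"
    and continuous_inv: "continuous_map T T (\<lambda>x. inv x)"

locale profinite_group = topological_group +
  assumes compact: "compact_space T"
    and Hausdorff: "Hausdorff_space T"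
    and totally_disconnected: "connectedin T C \<Longrightarrow> x \<in> C \<Longrightarrow> y \<in> C \<Longrightarrow> x = y"

text \<open>For profinite groups, generation is understood topologically.\<close>

definition topologically_finitely_generated ::
  "('a, 'b) monoid_scheme \<Rightarrow> 'a topology \<Rightarrow> bool" where
  "topologically_finitely_generated G T \<longleftrightarrow>
     (\<exists>S. finite S \<and> S \<subseteq> carrier G \<and> T closure_of generate G S = carrier G)"

definition borel_of :: "'a topology \<Rightarrow> 'a measure" where
  "borel_of T = sigma (topspace T) {U. openin T U}"

text \<open>
  The last clause is outer regularity; for a finite Borel measure on a compact Hausdorff space
  it also yields inner regularity with respect to compact sets, so together the clauses describe
  the normalized Haar (Radon) measure of a compact group.
\<close>

definition normalized_haar_measure ::
  "('a, 'b) monoid_scheme \<Rightarrow> 'a topology \<Rightarrow> 'a measure \<Rightarrow> bool" where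
  "normalized_haar_measure G T \<mu> \<longleftrightarrow>
     prob_space \<mu> \<and> sets \<mu> = sets (borel_of T) \<and>
     (\<forall>g \<in> carrier G. \<forall>A \<in> sets \<mu>. emeasure \<mu> (g <#\<^bsub>G\<^esub> A) = emeasure \<mu> A) \<and>
     (\<forall>A \<in> sets \<mu>. emeasure \<mu> A = (INF U \<in> {U. openin T U \<and> A \<subseteq> U}. emeasure \<mu> U))"

definition continuous_density ::
  "'a topology \<Rightarrow> 'a measure \<Rightarrow> 'a measure \<Rightarrow> ('a \<Rightarrow> real) \<Rightarrow> bool" where
  "continuous_density T \<nu> \<mu> f \<longleftrightarrow>
     continuous_map T euclideanreal f \<and> (\<forall>x \<in> topspace T. 0 \<le> f x) \<and>
     \<nu> = density \<mu> (\<lambda>x. ennreal (f x))"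

definition group_commutator :: "('a, 'b) monoid_scheme \<Rightarrow> 'a \<Rightarrow> 'a \<Rightarrow> 'a" where
  "group_commutator G x y = x \<otimes>\<^bsub>G\<^esub> y \<otimes>\<^bsub>G\<^esub> inv\<^bsub>G\<^esub> x \<otimes>\<^bsub>G\<^esub> inv\<^bsub>G\<^esub> y"

text \<open>
  A point \<open>(x\<^sub>1, y\<^sub>1, \<dots>, x\<^sub>n, y\<^sub>n)\<close> of the \<open>2n\<close>-th power is an
  extensional function \<open>z\<close> on \<open>{..<2 * n}\<close>, with \<open>x\<^sub>k = z (2 * (k - 1))\<close> and
  \<open>y\<^sub>k = z (2 * (k - 1) + 1)\<close>.
\<close>

primrec commutator_map :: "('a, 'b) monoid_scheme \<Rightarrow> nat \<Rightarrow> (nat \<Rightarrow> 'a) \<Rightarrow> 'a" where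
  "commutator_map G 0 z = \<one>\<^bsub>G\<^esub>"
| "commutator_map G (Suc k) z =
     commutator_map G k z \<otimes>\<^bsub>G\<^esub> group_commutator G (z (2 * k)) (z (2 * k + 1))"

abbreviation power_group :: "('a, 'b) monoid_scheme \<Rightarrow> nat \<Rightarrow> (nat \<Rightarrow> 'a) monoid" where
  "power_group G m \<equiv> product_group {..<m} (\<lambda>_. G)"

abbreviation power_topology :: "'a topology \<Rightarrow> nat \<Rightarrow> (nat \<Rightarrow> 'a) topology" where
  "power_topology T m \<equiv> product_topology (\<lambda>_. T) {..<m}"

abbreviation GL :: "nat \<Rightarrow> complex mat monoid" where
  "GL d \<equiv> units_of (ring_mat TYPE(complex) d ())"

definition continuous_representation ::
  "('a, 'b) monoid_scheme \<Rightarrow> 'a topology \<Rightarrow> nat \<Rightarrow> ('a \<Rightarrow> complex mat) \<Rightarrow> bool" where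
  "continuous_representation G T d \<rho> \<longleftrightarrow>
     \<rho> \<in> hom G (GL d) \<and>
     (\<forall>i < d. \<forall>j < d. continuous_map T euclidean (\<lambda>g. \<rho> g $$ (i, j)))"

definition irreducible_representation ::
  "('a, 'b) monoid_scheme \<Rightarrow> nat \<Rightarrow> ('a \<Rightarrow> complex mat) \<Rightarrow> bool" where
  "irreducible_representation G d \<rho> \<longleftrightarrow>
     d \<noteq> 0 \<and>
     (\<forall>W. VectorSpace.subspace class_ring W (module_vec TYPE(complex) d) \<longrightarrow>
        (\<forall>g \<in> carrier G. \<forall>w \<in> W. \<rho> g *\<^sub>v w \<in> W) \<longrightarrow>
        W = {0\<^sub>v d} \<or> W = carrier_vec d)"

definition mat_trace :: "'a :: comm_monoid_add mat \<Rightarrow> 'a" where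
  "mat_trace A = (\<Sum>i < dim_row A. A $$ (i, i))"

text \<open>
  Continuous irreducible representations of a compact group are finite-dimensional, hence
  isomorphic to one on some \<open>\<complex>\<^sup>d\<close>.  Characters are extensional on the carrier, so that
  equal characters are equal as elements of \<open>Irr G T\<close> and each occurs once in a sum.
\<close>

definition Irr :: "('a, 'b) monoid_scheme \<Rightarrow> 'a topology \<Rightarrow> ('a \<Rightarrow> complex) set" where
  "Irr G T = {\<lambda>g \<in> carrier G. mat_trace (\<rho> g) |d \<rho>.
     continuous_representation G T d \<rho> \<and> irreducible_representation G d \<rho>}"

end

theory Submission
  imports
    Defs
    "Jordan_Normal_Form.DL_Rank"
    "Jordan_Normal_Form.Schur_Decomposition"
    "Jordan_Normal_Form.Spectral_Radius"
begin

text \<open>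
  Because \<open>\<Gamma>\<close> is compact and the \<open>\<Gamma>(i)\<close> meet only in the identity, they form a basis of its
  neighbourhoods, and a group of complex matrices close to the identity is trivial. So every
  continuous representation factors through some finite quotient \<open>\<Gamma>/\<Gamma>(i)\<close>
  (\<open>representation_trivial_on_chain\<close>), and \<open>Irr \<Gamma>\<close> is the increasing union of the finite sets
  \<open>Irr \<Gamma>/\<Gamma>(i)\<close>.

  For a finite group \<open>Q\<close>, Frobenius' formula (\<open>frobenius_commutator_count\<close>)
  \<open>|{z \<in> Q\<^sup>2\<^sup>n. \<Phi>(z) = h}| = |Q|\<^sup>2\<^sup>n\<^sup>-\<^sup>1 \<Sum>\<^sub>\<chi> \<chi>(h)/\<chi>(1)\<^sup>2\<^sup>n\<^sup>-\<^sup>1\<close> counts the solutions of \<open>\<Phi>(z) = h\<close>.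
  Invariance of Haar measure gives all cosets of \<open>\<Gamma>(i)\<close> in \<open>\<Gamma>\<close>, and all boxes of such cosets in
  \<open>\<Gamma>\<^sup>2\<^sup>n\<close>, the same mass. So, with \<open>Q = \<Gamma>/\<Gamma>(i)\<close>, the push forward gives a coset \<open>\<Gamma>(i)g\<close> exactly
  \<open>|Q|\<^sup>-\<^sup>1\<close> times the partial sum, over \<open>Irr Q\<close>, of the series in the proposition (\<open>level_density_eq_sum\<close>). At \<open>g = 1\<close> this
  partial sum is \<open>\<Sum>\<^sub>\<chi> \<chi>(1)\<^sup>2\<^sup>-\<^sup>2\<^sup>n\<close>: boundedness of the ratios in the second condition is boundedness
  of the partial sums of a series of positive terms, hence its convergence
  (\<open>bounded_iff_summable\<close>).

  If the series converges, then \<open>|\<chi>(g)| \<le> \<chi>(1)\<close> makes the partial sums converge uniformly in \<open>g\<close>, so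
  the limit is continuous; it is nonnegative, because every partial sum is a ratio of measures, and
  it has the right integral over each coset of each \<open>\<Gamma>(i)\<close> (\<open>series_density_integral_coset\<close>). The cosets form an intersection-stable
  generator of the Borel sets, so the limit is the density. Conversely a continuous density on a
  compact space is bounded, which is the second condition.

  Frobenius' formula rests on two identities for irreducible characters of a finite group,
  \<open>\<Sum>\<^sub>x \<chi>(x y x\<^sup>-\<^sup>1 z) = |Q|/\<chi>(1) \<chi>(y) \<chi>(z)\<close> and \<open>\<Sum>\<^sub>y \<phi>(y) \<chi>(y\<^sup>-\<^sup>1 z) = \<delta>\<^sub>\<phi>\<^sub>\<chi> |Q|/\<chi>(1) \<chi>(z)\<close>, both
  consequences of Schur's lemma, and on \<open>\<Sum>\<^sub>\<chi> \<chi>(1) \<chi>(g) = |Q| \<delta>\<^sub>g\<^sub>1\<close>. For the last one, block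
  triangularisation writes the character of the regular representation as a sum of irreducible
  characters (\<open>character_sum_of_irreducible\<close>), and the second identity determines the multiplicities.
\<close>

section \<open>Matrices and bases adapted to a subspace\<close>

lemma subspace_vecI:
  fixes W :: "complex vec set"
  assumes "W \<subseteq> carrier_vec d" "0\<^sub>v d \<in> W"
    and "\<And>v w. v \<in> W \<Longrightarrow> w \<in> W \<Longrightarrow> v + w \<in> W"
    and "\<And>c v. v \<in> W \<Longrightarrow> c \<cdot>\<^sub>v v \<in> W"
  shows "VectorSpace.subspace class_ring W (module_vec TYPE(complex) d)"
proof -
  interpret vec_space "TYPE(complex)" d .
  show ?thesis
    unfolding VectorSpace.subspace_def submodule_def
    using assms vec_vs vec_module by (auto simp: module_vec_simps class_ring_simps)
qed

text \<open>
  The columns of \<open>S\<close> form a basis whose first \<open>k\<close> vectors span \<open>W\<close>, so that conjugating by \<open>S\<close> a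
  matrix that preserves \<open>W\<close> makes it block upper triangular.
\<close>

lemma adapted_basis:
  fixes W :: "complex vec set"
  assumes W: "VectorSpace.subspace class_ring W (module_vec TYPE(complex) d)"
    and nonzero: "W \<noteq> {0\<^sub>v d}" and proper: "W \<noteq> carrier_vec d"
  obtains k S S' where "0 < k" "k < d" "S \<in> carrier_mat d d" "S' \<in> carrier_mat d d"
    "S * S' = 1\<^sub>m d" "S' * S = 1\<^sub>m d"
    "\<And>j. j < k \<Longrightarrow> col S j \<in> W"
    "\<And>w i. w \<in> W \<Longrightarrow> k \<le> i \<Longrightarrow> i < d \<Longrightarrow> (S' *\<^sub>v w) $ i = 0"
proof -
  interpret vec_space "TYPE(complex)" d .
  have sub: "submodule class_ring W V" using W unfolding VectorSpace.subspace_def by simp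
  have Wc: "W \<subseteq> carrier_vec d" using sub by (auto simp: submodule_def module_vec_simps)
  let ?P = "\<lambda>A. A \<subseteq> W \<and> lin_indpt A"
  have bound: "finite A \<and> card A \<le> d" if "A \<subseteq> carrier_vec d" "lin_indpt A" for A
    using li_le_dim[OF fin_dim] that dim_is_n by auto
  have "lin_indpt {}" unfolding lin_dep_def by auto
  then have P0: "?P {}" by simp
  obtain B0 where B0: "finite B0" "maximal B0 ?P"
    using maximal_exists[of ?P d "{}"] bound Wc P0 by blast
  have B0W: "B0 \<subseteq> W" "lin_indpt B0" using B0(2) unfolding maximal_def by auto
  have B0c: "B0 \<subseteq> carrier_vec d" using B0W Wc by auto
  have spanB0: "w \<in> span B0" if w: "w \<in> W" for w
  proof (rule ccontr)
    assume n: "w \<notin> span B0"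
    then have nB: "w \<notin> B0" using in_own_span[OF B0c] by auto
    have "lin_indpt (B0 \<union> {w})" using lin_dep_iff_in_span[OF B0c B0W(2) _ nB] n w Wc by auto
    then have "B0 \<union> {w} = B0" using B0(2) B0W w unfolding maximal_def by auto
    then show False using nB by auto
  qed
  let ?Q = "\<lambda>A. B0 \<subseteq> A \<and> A \<subseteq> carrier_vec d \<and> lin_indpt A"
  obtain B where B: "finite B" "maximal B ?Q"
    using maximal_exists[of ?Q d B0] bound B0W B0c by blast
  have BQ: "B0 \<subseteq> B" "B \<subseteq> carrier_vec d" "lin_indpt B" using B(2) unfolding maximal_def by auto
  have "maximal B (\<lambda>S. S \<subseteq> carrier_vec d \<and> lin_indpt S)"
    unfolding maximal_def
  proof (intro conjI allI impI)
    fix A assume "B \<subseteq> A \<and> A \<subseteq> carrier_vec d \<and> lin_indpt A"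
    then have "B \<subseteq> A" "?Q A" using BQ(1) by blast+
    then show "A = B" using B(2) unfolding maximal_def by blast
  qed (use BQ in blast)+
  then have basis: "basis B" by (rule max_li_is_basis)
  have cardB: "card B = d" using dim_basis[OF B(1) basis] dim_is_n by simp
  obtain us where us: "set us = B0" "distinct us" using finite_distinct_list[OF B0(1)] by auto
  obtain vs where vs: "set vs = B - B0" "distinct vs" using finite_distinct_list[of "B - B0"] B(1) by auto
  define bs where "bs = us @ vs"
  have bs: "set bs = B" "distinct bs" using us vs BQ by (auto simp: bs_def)
  have len: "length bs = d" using bs cardB distinct_card by fastforce
  define k where "k = length us"
  \<comment> \<open>The vectors of \<open>B0\<close> come first, so that they become the first \<open>k\<close> columns.\<close>
  define S where "S = mat_of_cols d bs"
  have S: "S \<in> carrier_mat d d" using len by (auto simp: S_def)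
  have colsS: "cols S = bs" unfolding S_def using bs BQ by (intro cols_mat_of_cols) auto
  have "det S \<noteq> 0"
    using lin_indpt_full_rank[OF S] det_rank_iff[OF S] colsS bs BQ by auto
  then obtain S' where S': "S' \<in> carrier_mat d d" "S * S' = 1\<^sub>m d" "S' * S = 1\<^sub>m d"
    using det_non_zero_imp_unit[OF S, of undefined] unfolding Units_def
    by (auto simp: ring_mat_simps)
  have colj: "col S j = bs ! j" if "j < d" for j
    using that colsS S by (metis cols_nth carrier_matD(2))
  show ?thesis
  proof (rule that[of k S S'])
    have "0\<^sub>v d \<in> W" using sub by (auto simp: submodule_def module_vec_simps)
    have "B0 \<noteq> {}"
    proof
      assume "B0 = {}"
      then have "W \<subseteq> {0\<^sub>v d}" using spanB0 span_empty by blast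
      then show False using nonzero \<open>0\<^sub>v d \<in> W\<close> by blast
    qed
    then show "0 < k" using us by (auto simp: k_def)
    have "card B0 \<noteq> d"
    proof
      assume "card B0 = d"
      then have "B0 = B" using cardB BQ B(1) card_subset_eq by metis
      then have "span B \<subseteq> W" using span_is_subset[OF _ sub] B0W by auto
      then show False using basis Wc proper unfolding basis_def by auto
    qed
    then show kd: "k < d" using len us distinct_card[of us] by (auto simp: bs_def k_def)
    show "col S j \<in> W" if "j < k" for j
      using colj[of j] that kd us B0W by (auto simp: bs_def k_def nth_append)
    show "(S' *\<^sub>v w) $ i = 0" if w: "w \<in> W" and i: "k \<le> i" "i < d" for w i
    proof -
      obtain a where a: "w = lincomb a B0"
        using spanB0[OF w] finite_span[OF B0(1) B0c] by auto
      define b where "b = (\<lambda>x. if x \<in> B0 then a x else 0)"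
      have "lincomb b (B0 \<union> (B - B0)) = lincomb b B0 + lincomb b (B - B0)"
        using BQ B(1) B0(1) by (intro lincomb_union) auto
      moreover have "B0 \<union> (B - B0) = B" using BQ by auto
      ultimately have "lincomb b B = lincomb b B0 + lincomb b (B - B0)" by simp
      also have "lincomb b (B - B0) = 0\<^sub>v d"
        unfolding b_def using BQ by (intro lincomb_zero) (auto)
      also have "lincomb b B0 = w"
        unfolding a using B0c by (intro lincomb_cong) (auto simp: b_def)
      finally have wb: "lincomb b B = w" using w Wc by auto
      define v where "v = vec d (\<lambda>i. b (col S i))"
      have v: "v \<in> carrier_vec d" by (simp add: v_def)
      have "S *\<^sub>v v = w"
        using mat_mult_eq_lincomb[OF S, of b] colsS bs wb by (simp add: v_def)
      then have "S' *\<^sub>v w = v"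
        using assoc_mult_mat_vec[OF S'(1) S v] S' v by auto
      moreover have "bs ! i \<notin> B0"
      proof -
        have "bs ! i = vs ! (i - k)" "i - k < length vs"
          using i len by (auto simp: bs_def k_def nth_append)
        then show ?thesis using vs nth_mem by auto
      qed
      ultimately show ?thesis using i colj[of i] by (simp add: v_def b_def)
    qed
  qed (use S S' in auto)
qed

lemma hom_GL_iff:
  fixes G (structure)
  assumes "group G"
  shows "\<rho> \<in> hom G (GL d) \<longleftrightarrow>
     (\<forall>g\<in>carrier G. \<rho> g \<in> carrier_mat d d) \<and> \<rho> \<one> = 1\<^sub>m d \<and>
     (\<forall>g\<in>carrier G. \<forall>h\<in>carrier G. \<rho> (g \<otimes> h) = \<rho> g * \<rho> h)"  (is "?L \<longleftrightarrow> ?R")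
proof
  interpret group G by fact
  interpret R: ring "ring_mat TYPE(complex) d ()" by (rule ring_mat)
  have gl: "group (GL d)" by (rule R.units_group)
  assume L: ?L
  interpret h: group_hom G "GL d" \<rho> by (intro group_hom.intro group_hom_axioms.intro assms gl L)
  show ?R using L h.hom_one by (auto simp: hom_def units_of_def Pi_def Units_def ring_mat_simps)
next
  interpret group G by fact
  assume R: ?R
  have "\<rho> g \<in> Units (ring_mat TYPE(complex) d ())" if g: "g \<in> carrier G" for g
  proof -
    have "\<rho> g * \<rho> (inv g) = 1\<^sub>m d" "\<rho> (inv g) * \<rho> g = 1\<^sub>m d" "\<rho> (inv g) \<in> carrier_mat d d"
      using R g inv_closed[OF g] r_inv[OF g] l_inv[OF g] by metis+
    then show ?thesis using R g unfolding Units_def by (auto simp: ring_mat_simps)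
  qed
  then show ?L using R by (auto simp: hom_def units_of_def ring_mat_simps)
qed

lemma mat_trace_comm:
  fixes A :: "complex mat"
  assumes "A \<in> carrier_mat n m" "B \<in> carrier_mat m n"
  shows "mat_trace (A * B) = mat_trace (B * A)"
proof -
  have "mat_trace (A * B) = (\<Sum>i<n. \<Sum>j<m. A $$ (i, j) * B $$ (j, i))"
    using assms by (auto simp: mat_trace_def scalar_prod_def atLeast0LessThan)
  also have "\<dots> = (\<Sum>j<m. \<Sum>i<n. B $$ (j, i) * A $$ (i, j))"
    by (subst sum.swap) (simp add: mult.commute)
  also have "\<dots> = mat_trace (B * A)"
    using assms by (auto simp: mat_trace_def scalar_prod_def atLeast0LessThan)
  finally show ?thesis .
qed

lemma mat_trace_similar:
  fixes A :: "complex mat"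
  assumes "A \<in> carrier_mat n n" "S \<in> carrier_mat n m" "S' \<in> carrier_mat m n" "S * S' = 1\<^sub>m n"
  shows "mat_trace (S' * A * S) = mat_trace A"
proof -
  have "mat_trace (S' * A * S) = mat_trace (S * (S' * A))"
    using assms by (intro mat_trace_comm[of _ m n]) auto
  also have "S * (S' * A) = A" using assms assoc_mult_mat[of S n m S' n A n] by auto
  finally show ?thesis .
qed

lemma mat_mult_entry:
  fixes A :: "complex mat"
  assumes "A \<in> carrier_mat n m" "B \<in> carrier_mat m k" "i < n" "j < k"
  shows "(A * B) $$ (i, j) = (\<Sum>l<m. A $$ (i, l) * B $$ (l, j))"
  using assms by (auto simp: scalar_prod_def atLeast0LessThan)

section \<open>Characters as sums of irreducible characters\<close>

lemma continuous_representationD: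
  fixes G (structure)
  assumes "group G" "continuous_representation G T d \<rho>"
  shows "g \<in> carrier G \<Longrightarrow> \<rho> g \<in> carrier_mat d d"
    and "\<rho> \<one>\<^bsub>G\<^esub> = 1\<^sub>m d"
    and "g \<in> carrier G \<Longrightarrow> h \<in> carrier G \<Longrightarrow> \<rho> (g \<otimes>\<^bsub>G\<^esub> h) = \<rho> g * \<rho> h"
    and "i < d \<Longrightarrow> j < d \<Longrightarrow> continuous_map T euclidean (\<lambda>g. \<rho> g $$ (i, j))"
  using assms(2) hom_GL_iff[OF assms(1), of \<rho> d] unfolding continuous_representation_def by auto

lemma continuous_representationI:
  fixes G (structure)
  assumes "group G"
    and "\<And>g. g \<in> carrier G \<Longrightarrow> \<rho> g \<in> carrier_mat d d"
    and "\<rho> \<one>\<^bsub>G\<^esub> = 1\<^sub>m d"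
    and "\<And>g h. g \<in> carrier G \<Longrightarrow> h \<in> carrier G \<Longrightarrow> \<rho> (g \<otimes>\<^bsub>G\<^esub> h) = \<rho> g * \<rho> h"
    and "\<And>i j. i < d \<Longrightarrow> j < d \<Longrightarrow> continuous_map T euclidean (\<lambda>g. \<rho> g $$ (i, j))"
  shows "continuous_representation G T d \<rho>"
  using assms(2-) hom_GL_iff[OF assms(1), of \<rho> d] unfolding continuous_representation_def by auto

lemma continuous_map_normed_algebra_mult:
  fixes f g :: "'a \<Rightarrow> 'b::real_normed_algebra"
  assumes "continuous_map S euclidean f" "continuous_map S euclidean g"
  shows "continuous_map S euclidean (\<lambda>x. f x * g x)"
  using assms by (simp add: continuous_map_atin tendsto_mult)

lemma sum_split_at:
  fixes f :: "nat \<Rightarrow> 'a::comm_monoid_add"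
  assumes "k \<le> d"
  shows "(\<Sum>l<d. f l) = (\<Sum>l<k. f l) + (\<Sum>l<d-k. f (l + k))"
proof -
  have "(\<Sum>l<d. f l) = (\<Sum>l<k. f l) + (\<Sum>l=k..<d. f l)"
    using assms by (metis lessThan_atLeast0 le0 sum.atLeastLessThan_concat)
  also have "(\<Sum>l=k..<d. f l) = (\<Sum>l<d-k. f (l + k))"
    using sum.shift_bounds_nat_ivl[of f 0 k "d-k"] assms by (simp add: lessThan_atLeast0)
  finally show ?thesis .
qed

text \<open>
  An invariant subspace makes the representation block upper triangular. Both diagonal blocks are
  continuous representations of smaller degree, and the trace is the sum of their traces.
\<close>

lemma character_sum_of_irreducible:
  fixes G (structure) and T :: "'a topology"
  assumes G: "group G" and top: "topspace T = carrier G"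
    and "continuous_representation G T d \<rho>"
  shows "\<exists>xs. set xs \<subseteq> Irr G T \<and> (\<forall>g\<in>carrier G. mat_trace (\<rho> g) = (\<Sum>\<psi>\<leftarrow>xs. \<psi> g))"
  using assms(3)
proof (induction d arbitrary: \<rho> rule: less_induct)
  case (less d \<rho>)
  interpret group G by fact
  note rep = continuous_representationD[OF G less.prems]
  consider "d = 0" | "irreducible_representation G d \<rho>"
    | W where "VectorSpace.subspace class_ring W (module_vec TYPE(complex) d)"
      "\<forall>g \<in> carrier G. \<forall>w \<in> W. \<rho> g *\<^sub>v w \<in> W" "W \<noteq> {0\<^sub>v d}" "W \<noteq> carrier_vec d"
    unfolding irreducible_representation_def by blast
  then show ?case
  proof cases
    case 1
    then have "dim_row (\<rho> g) = 0" if "g \<in> carrier G" for g using rep(1)[OF that] by auto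
    then show ?thesis by (intro exI[of _ "[]"]) (auto simp: mat_trace_def)
  next
    case 2
    have "(\<lambda>g\<in>carrier G. mat_trace (\<rho> g)) \<in> Irr G T"
      unfolding Irr_def using less.prems 2 by blast
    then show ?thesis by (intro exI[of _ "[\<lambda>g\<in>carrier G. mat_trace (\<rho> g)]"]) auto
  next
    case (3 W)
    obtain k S S' where k: "0 < k" "k < d" and S: "S \<in> carrier_mat d d" "S' \<in> carrier_mat d d"
      "S * S' = 1\<^sub>m d" "S' * S = 1\<^sub>m d"
      and colW: "\<And>j. j < k \<Longrightarrow> col S j \<in> W"
      and zero: "\<And>w i. w \<in> W \<Longrightarrow> k \<le> i \<Longrightarrow> i < d \<Longrightarrow> (S' *\<^sub>v w) $ i = 0"
      using adapted_basis[OF 3(1) 3(3) 3(4)] by blast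
    have W: "W \<subseteq> carrier_vec d"
      using 3(1) by (auto simp: VectorSpace.subspace_def submodule_def module_vec_simps)
    define \<tau> where "\<tau> = (\<lambda>g. S' * \<rho> g * S)"
    have \<tau>c: "\<tau> g \<in> carrier_mat d d" if "g \<in> carrier G" for g
      using rep(1)[OF that] S by (simp add: \<tau>_def)
    have \<tau>one: "\<tau> \<one> = 1\<^sub>m d" using rep(2) S by (simp add: \<tau>_def)
    have \<tau>mult: "\<tau> (g \<otimes> h) = \<tau> g * \<tau> h" if gh: "g \<in> carrier G" "h \<in> carrier G" for g h
    proof -
      note c = rep(1)[OF gh(1)] rep(1)[OF gh(2)] S(1,2)
      have "\<tau> g * \<tau> h = S' * (\<rho> g * (S * S') * \<rho> h) * S"
        using c unfolding \<tau>_def by (simp add: assoc_mult_mat[of _ d d _ d _ d])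
      also have "\<dots> = S' * (\<rho> g * \<rho> h) * S" using c S by simp
      finally show ?thesis using rep(3)[OF gh] by (simp add: \<tau>_def)
    qed
    have \<tau>cont: "continuous_map T euclidean (\<lambda>g. \<tau> g $$ (i, j))" if ij: "i < d" "j < d" for i j
    proof -
      have "continuous_map T euclidean (\<lambda>g. \<Sum>l<d. (\<Sum>m<d. S' $$ (i, m) * \<rho> g $$ (m, l)) * S $$ (l, j))"
        using rep(4) by (intro continuous_map_sum continuous_map_normed_algebra_mult) auto
      then show ?thesis
      proof (rule continuous_map_eq)
        fix g assume "g \<in> topspace T"
        then have g: "\<rho> g \<in> carrier_mat d d" using top rep(1) by simp
        then have "S' * \<rho> g \<in> carrier_mat d d" using S by simp
        from mat_mult_entry[OF this S(1) ij] mat_mult_entry[OF S(2) g ij(1)]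
        show "(\<Sum>l<d. (\<Sum>m<d. S' $$ (i, m) * \<rho> g $$ (m, l)) * S $$ (l, j)) = \<tau> g $$ (i, j)"
          by (simp add: \<tau>_def)
      qed
    qed
    have \<tau>block: "\<tau> g $$ (i, j) = 0" if g: "g \<in> carrier G" and ij: "k \<le> i" "i < d" "j < k" for g i j
    proof -
      have "\<tau> g $$ (i, j) = (S' *\<^sub>v (\<rho> g *\<^sub>v col S j)) $ i"
        using rep(1)[OF g] S ij k
        by (simp add: \<tau>_def assoc_mult_mat[of S' d d "\<rho> g" d S d] mult_mat_vec_def)
      also have "\<rho> g *\<^sub>v col S j \<in> W" using 3(2) g colW ij by auto
      from zero[OF this ij(1,2)] have "(S' *\<^sub>v (\<rho> g *\<^sub>v col S j)) $ i = 0" .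
      finally show ?thesis .
    qed
    define \<alpha> where "\<alpha> = (\<lambda>g. mat k k (\<lambda>(i, j). \<tau> g $$ (i, j)))"
    define \<delta> where "\<delta> = (\<lambda>g. mat (d-k) (d-k) (\<lambda>(i, j). \<tau> g $$ (i+k, j+k)))"
    have "continuous_representation G T k \<alpha>"
    proof (rule continuous_representationI[OF G])
      fix g h assume gh: "g \<in> carrier G" "h \<in> carrier G"
      show "\<alpha> (g \<otimes> h) = \<alpha> g * \<alpha> h"
      proof (rule eq_matI)
        fix i j assume "i < dim_row (\<alpha> g * \<alpha> h)" "j < dim_col (\<alpha> g * \<alpha> h)"
        then have ij: "i < k" "j < k" by (auto simp: \<alpha>_def)
        have "\<alpha> (g \<otimes> h) $$ (i, j) = (\<Sum>l<d. \<tau> g $$ (i, l) * \<tau> h $$ (l, j))"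
          using ij k \<tau>mult[OF gh] mat_mult_entry[OF \<tau>c[OF gh(1)] \<tau>c[OF gh(2)], of i j]
          by (simp add: \<alpha>_def)
        also have "\<dots> = (\<Sum>l<k. \<tau> g $$ (i, l) * \<tau> h $$ (l, j))"
          unfolding sum_split_at[OF less_imp_le[OF k(2)]] using \<tau>block[OF gh(2)] ij by simp
        also have "\<dots> = (\<alpha> g * \<alpha> h) $$ (i, j)"
          using ij by (subst mat_mult_entry[of _ k k _ k]) (auto simp: \<alpha>_def)
        finally show "\<alpha> (g \<otimes> h) $$ (i, j) = (\<alpha> g * \<alpha> h) $$ (i, j)" .
      qed (auto simp: \<alpha>_def)
    qed (use \<tau>one \<tau>cont k in \<open>auto simp: \<alpha>_def intro!: eq_matI\<close>)
    from less.IH[OF k(2) this] obtain xs where xs: "set xs \<subseteq> Irr G T"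
      "\<forall>g\<in>carrier G. mat_trace (\<alpha> g) = (\<Sum>\<psi>\<leftarrow>xs. \<psi> g)" by blast
    have "continuous_representation G T (d-k) \<delta>"
    proof (rule continuous_representationI[OF G])
      fix g h assume gh: "g \<in> carrier G" "h \<in> carrier G"
      show "\<delta> (g \<otimes> h) = \<delta> g * \<delta> h"
      proof (rule eq_matI)
        fix i j assume "i < dim_row (\<delta> g * \<delta> h)" "j < dim_col (\<delta> g * \<delta> h)"
        then have ij: "i < d-k" "j < d-k" by (auto simp: \<delta>_def)
        have "\<delta> (g \<otimes> h) $$ (i, j) = (\<Sum>l<d. \<tau> g $$ (i+k, l) * \<tau> h $$ (l, j+k))"
          using ij k \<tau>mult[OF gh] mat_mult_entry[OF \<tau>c[OF gh(1)] \<tau>c[OF gh(2)], of "i+k" "j+k"]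
          by (simp add: \<delta>_def)
        also have "\<dots> = (\<Sum>l<d-k. \<tau> g $$ (i+k, l+k) * \<tau> h $$ (l+k, j+k))"
          unfolding sum_split_at[OF less_imp_le[OF k(2)]] using \<tau>block[OF gh(1)] ij by simp
        also have "\<dots> = (\<delta> g * \<delta> h) $$ (i, j)"
          using ij by (subst mat_mult_entry[of _ "d-k" "d-k" _ "d-k"]) (auto simp: \<delta>_def)
        finally show "\<delta> (g \<otimes> h) $$ (i, j) = (\<delta> g * \<delta> h) $$ (i, j)" .
      qed (auto simp: \<delta>_def)
    qed (use \<tau>one \<tau>cont k in \<open>auto simp: \<delta>_def intro!: eq_matI\<close>)
    from less.IH[OF _ this] k obtain ys where ys: "set ys \<subseteq> Irr G T"
      "\<forall>g\<in>carrier G. mat_trace (\<delta> g) = (\<Sum>\<psi>\<leftarrow>ys. \<psi> g)" by auto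
    have "mat_trace (\<rho> g) = mat_trace (\<alpha> g) + mat_trace (\<delta> g)" if g: "g \<in> carrier G" for g
    proof -
      have "mat_trace (\<rho> g) = mat_trace (\<tau> g)"
        unfolding \<tau>_def using mat_trace_similar[OF rep(1)[OF g] S(1,2,3)] by simp
      also have "\<dots> = mat_trace (\<alpha> g) + mat_trace (\<delta> g)"
        using \<tau>c[OF g] k by (simp add: mat_trace_def sum_split_at[of k d] \<alpha>_def \<delta>_def)
      finally show ?thesis .
    qed
    then show ?thesis using xs ys by (intro exI[of _ "xs @ ys"]) auto
  qed
qed

section \<open>Schur's lemma and orthogonality of matrix coefficients\<close>

lemma mat_zero_if_mult_vec_zero:
  fixes B :: "complex mat"
  assumes B: "B \<in> carrier_mat e d" and "\<And>v. v \<in> carrier_vec d \<Longrightarrow> B *\<^sub>v v = 0\<^sub>v e"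
  shows "B = 0\<^sub>m e d"
proof (rule eq_matI)
  fix i j assume "i < dim_row (0\<^sub>m e d :: complex mat)" "j < dim_col (0\<^sub>m e d :: complex mat)"
  then have ij: "i < e" "j < d" by auto
  have "B $$ (i, j) = (B *\<^sub>v unit_vec d j) $ i" using B ij by (simp add: scalar_prod_right_unit)
  also have "\<dots> = 0" using assms(2)[of "unit_vec d j"] ij by simp
  finally show "B $$ (i, j) = 0\<^sub>m e d $$ (i, j)" using ij by simp
qed (use B in auto)

lemma mat_eq_of_diff_zero:
  fixes A B :: "complex mat"
  assumes A: "A \<in> carrier_mat n m" and B: "B \<in> carrier_mat n m" and diff: "A - B = 0\<^sub>m n m"
  shows "A = B"
proof (rule eq_matI)
  fix i j assume "i < dim_row B" "j < dim_col B"
  then have "i < n" "j < m" using B by auto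
  moreover have "(A - B) $$ (i, j) = 0\<^sub>m n m $$ (i, j)" using diff by simp
  ultimately show "A $$ (i, j) = B $$ (i, j)" using A B by simp
qed (use A B in auto)

lemma mult_vec_kernel_subspace:
  fixes B :: "complex mat"
  assumes B: "B \<in> carrier_mat e d"
  shows "VectorSpace.subspace class_ring {v \<in> carrier_vec d. B *\<^sub>v v = 0\<^sub>v e} (module_vec TYPE(complex) d)"
  using B by (intro subspace_vecI)
    (auto simp: mult_add_distrib_mat_vec[OF B] mult_mat_vec[OF B])

lemma mult_vec_image_subspace:
  fixes B :: "complex mat"
  assumes B: "B \<in> carrier_mat e d"
  shows "VectorSpace.subspace class_ring ((\<lambda>v. B *\<^sub>v v) ` carrier_vec d) (module_vec TYPE(complex) e)"
proof (rule subspace_vecI)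
  show "0\<^sub>v e \<in> (\<lambda>v. B *\<^sub>v v) ` carrier_vec d"
    using B by (intro image_eqI[of _ _ "0\<^sub>v d"]) auto
  show "v + w \<in> (\<lambda>v. B *\<^sub>v v) ` carrier_vec d"
    if "v \<in> (\<lambda>v. B *\<^sub>v v) ` carrier_vec d" "w \<in> (\<lambda>v. B *\<^sub>v v) ` carrier_vec d" for v w
    using that by (auto simp flip: mult_add_distrib_mat_vec[OF B])
  show "c \<cdot>\<^sub>v v \<in> (\<lambda>v. B *\<^sub>v v) ` carrier_vec d" if "v \<in> (\<lambda>v. B *\<^sub>v v) ` carrier_vec d" for c v
    using that by (auto simp flip: mult_mat_vec[OF B])
qed (use B in auto)

text \<open>
  Schur's lemma for two representations. A nonzero intertwiner has trivial kernel and full image,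
  hence a two-sided inverse, which conjugates one representation into the other.
\<close>

lemma intertwiner_zero_or_same_trace:
  fixes G (structure) and B :: "complex mat"
  assumes G: "group G"
    and \<rho>: "continuous_representation G T d \<rho>" "irreducible_representation G d \<rho>"
    and \<sigma>: "continuous_representation G T e \<sigma>" "irreducible_representation G e \<sigma>"
    and B: "B \<in> carrier_mat e d"
    and inter: "\<And>g. g \<in> carrier G \<Longrightarrow> \<sigma> g * B = B * \<rho> g"
  shows "B = 0\<^sub>m e d \<or> (\<forall>g\<in>carrier G. mat_trace (\<sigma> g) = mat_trace (\<rho> g))"
proof (cases "B = 0\<^sub>m e d")
  case False
  note r = continuous_representationD[OF G \<rho>(1)] and s = continuous_representationD[OF G \<sigma>(1)]
  have move: "\<sigma> g *\<^sub>v (B *\<^sub>v v) = B *\<^sub>v (\<rho> g *\<^sub>v v)" if "g \<in> carrier G" "v \<in> carrier_vec d" for g v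
    using assoc_mult_mat_vec[OF s(1)[OF that(1)] B that(2)] inter[OF that(1)]
      assoc_mult_mat_vec[OF B r(1)[OF that(1)] that(2)] by simp
  define K where "K = {v \<in> carrier_vec d. B *\<^sub>v v = 0\<^sub>v e}"
  define M where "M = (\<lambda>v. B *\<^sub>v v) ` carrier_vec d"
  have "\<forall>g \<in> carrier G. \<forall>w \<in> K. \<rho> g *\<^sub>v w \<in> K"
  proof (intro ballI)
    fix g v assume g: "g \<in> carrier G" and v: "v \<in> K"
    then have "v \<in> carrier_vec d" "B *\<^sub>v v = 0\<^sub>v e" by (auto simp: K_def)
    moreover have "\<sigma> g *\<^sub>v 0\<^sub>v e = 0\<^sub>v e" using s(1)[OF g] by (intro eq_vecI) auto
    ultimately show "\<rho> g *\<^sub>v v \<in> K"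
      using move[OF g, of v] mult_mat_vec_carrier[OF r(1)[OF g]] by (simp add: K_def)
  qed
  then have "K = {0\<^sub>v d} \<or> K = carrier_vec d"
    using \<rho>(2) mult_vec_kernel_subspace[OF B] unfolding irreducible_representation_def K_def by blast
  moreover have "K \<noteq> carrier_vec d"
    using mat_zero_if_mult_vec_zero[OF B] False unfolding K_def by blast
  ultimately have K: "K = {0\<^sub>v d}" by blast
  have "\<forall>g \<in> carrier G. \<forall>w \<in> M. \<sigma> g *\<^sub>v w \<in> M"
    using mult_mat_vec_carrier[OF r(1)] by (auto simp: M_def move)
  then have "M = {0\<^sub>v e} \<or> M = carrier_vec e"
    using \<sigma>(2) mult_vec_image_subspace[OF B] unfolding irreducible_representation_def M_def by blast
  moreover have "M \<noteq> {0\<^sub>v e}"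
    using mat_zero_if_mult_vec_zero[OF B] False unfolding M_def by blast
  ultimately have M: "M = carrier_vec e" by blast
  have "\<forall>i. \<exists>v. i < e \<longrightarrow> v \<in> carrier_vec d \<and> B *\<^sub>v v = unit_vec e i"
    using M unfolding M_def by (metis imageE unit_vec_carrier)
  then obtain c where c: "\<And>i. i < e \<Longrightarrow> c i \<in> carrier_vec d \<and> B *\<^sub>v c i = unit_vec e i" by metis
  \<comment> \<open>The columns of \<open>C\<close> are preimages of the unit vectors, so \<open>C\<close> is a right inverse of \<open>B\<close>.\<close>
  define C where "C = mat d e (\<lambda>(j, i). c i $ j)"
  have C: "C \<in> carrier_mat d e" by (simp add: C_def)
  have BC: "B * C = 1\<^sub>m e"
  proof (rule eq_matI)
    fix k i assume "k < dim_row (1\<^sub>m e :: complex mat)" "i < dim_col (1\<^sub>m e :: complex mat)"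
    then have ki: "k < e" "i < e" by auto
    have "col C i = c i" using c[OF ki(2)] ki by (intro eq_vecI) (auto simp: C_def)
    then have "(B * C) $$ (k, i) = (B *\<^sub>v c i) $ k" using B C ki by simp
    then show "(B * C) $$ (k, i) = 1\<^sub>m e $$ (k, i)" using c[OF ki(2)] ki by simp
  qed (use B C in auto)
  have CB: "C * B = 1\<^sub>m d"
  proof -
    have "C * B - 1\<^sub>m d = 0\<^sub>m d d"
    proof (rule mat_zero_if_mult_vec_zero)
      fix v :: "complex vec" assume v: "v \<in> carrier_vec d"
      have "B *\<^sub>v (C *\<^sub>v (B *\<^sub>v v)) = (B * C) *\<^sub>v (B *\<^sub>v v)"
        using B C v by (intro assoc_mult_mat_vec[symmetric]) auto
      then have "B *\<^sub>v ((C * B) *\<^sub>v v - v) = 0\<^sub>v e"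
        using B C v BC by (simp add: mult_minus_distrib_mat_vec[OF B] assoc_mult_mat_vec[OF C B])
      then have "(C * B) *\<^sub>v v - v \<in> K" using B C v by (simp add: K_def)
      then show "(C * B - 1\<^sub>m d) *\<^sub>v v = 0\<^sub>v d"
        using K B C v by (simp add: minus_mult_distrib_mat_vec[of _ d d])
    qed (use B C in auto)
    from mat_eq_of_diff_zero[OF _ _ this] show ?thesis using B C by simp
  qed
  have "mat_trace (\<sigma> g) = mat_trace (\<rho> g)" if g: "g \<in> carrier G" for g
  proof -
    have "C * \<sigma> g * B = C * (B * \<rho> g)"
      using inter[OF g] assoc_mult_mat[OF C s(1)[OF g] B] by simp
    also have "\<dots> = \<rho> g" using assoc_mult_mat[OF C B r(1)[OF g]] CB r(1)[OF g] by simp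
    finally show ?thesis using mat_trace_similar[OF s(1)[OF g] B C BC] by simp
  qed
  then show ?thesis by blast
qed simp

text \<open>
  Schur's lemma for one representation: an eigenspace of \<open>B\<close> is invariant and nonzero, so it is the
  whole space.
\<close>

lemma commutant_scalar:
  fixes G (structure) and B :: "complex mat"
  assumes G: "group G"
    and \<rho>: "continuous_representation G T d \<rho>" "irreducible_representation G d \<rho>"
    and B: "B \<in> carrier_mat d d"
    and comm: "\<And>g. g \<in> carrier G \<Longrightarrow> \<rho> g * B = B * \<rho> g"
  obtains c where "B = c \<cdot>\<^sub>m 1\<^sub>m d"
proof -
  note r = continuous_representationD[OF G \<rho>(1)]
  have "d > 0" using \<rho>(2) by (simp add: irreducible_representation_def)
  from spectrum_non_empty[OF B this] obtain c where "eigenvalue B c"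
    by (auto simp: spectrum_def)
  then obtain u where u: "u \<in> carrier_vec d" "u \<noteq> 0\<^sub>v d" "B *\<^sub>v u = c \<cdot>\<^sub>v u"
    using B unfolding eigenvalue_def eigenvector_def by auto
  define A where "A = B - c \<cdot>\<^sub>m 1\<^sub>m d"
  have A: "A \<in> carrier_mat d d" by (simp add: A_def minus_carrier_mat)
  have Av: "A *\<^sub>v v = B *\<^sub>v v - c \<cdot>\<^sub>v v" if "v \<in> carrier_vec d" for v
  proof -
    have "(c \<cdot>\<^sub>m 1\<^sub>m d) *\<^sub>v v = c \<cdot>\<^sub>v v" using that by (intro eq_vecI) auto
    then show ?thesis using B that by (simp add: A_def minus_mult_distrib_mat_vec[of _ d d])
  qed
  define K where "K = {v \<in> carrier_vec d. A *\<^sub>v v = 0\<^sub>v d}"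
  have "\<rho> g *\<^sub>v v \<in> K" if g: "g \<in> carrier G" and v: "v \<in> K" for g v
  proof -
    have v': "v \<in> carrier_vec d" "A *\<^sub>v v = 0\<^sub>v d" using v by (auto simp: K_def)
    have "A * \<rho> g = \<rho> g * A"
      using comm[OF g] B r(1)[OF g]
      by (simp add: A_def minus_mult_distrib_mat[of _ d d] mult_minus_distrib_mat[of _ d d]
          mult_smult_distrib[of "\<rho> g" d d "1\<^sub>m d" d] mult_smult_assoc_mat[of _ d d])
    then have "A *\<^sub>v (\<rho> g *\<^sub>v v) = \<rho> g *\<^sub>v (A *\<^sub>v v)"
      using assoc_mult_mat_vec[OF A r(1)[OF g] v'(1)] assoc_mult_mat_vec[OF r(1)[OF g] A v'(1)] by simp
    moreover have "\<rho> g *\<^sub>v 0\<^sub>v d = 0\<^sub>v d" using r(1)[OF g] by (intro eq_vecI) auto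
    ultimately show ?thesis using mult_mat_vec_carrier[OF r(1)[OF g]] v' by (simp add: K_def)
  qed
  then have "K = {0\<^sub>v d} \<or> K = carrier_vec d"
    using \<rho>(2) mult_vec_kernel_subspace[OF A] unfolding irreducible_representation_def K_def by blast
  moreover have "u \<in> K" using u Av by (simp add: K_def)
  ultimately have "K = carrier_vec d" using u by blast
  then have "A = 0\<^sub>m d d" by (intro mat_zero_if_mult_vec_zero[OF A]) (auto simp: K_def)
  then have "B = c \<cdot>\<^sub>m 1\<^sub>m d" using B unfolding A_def by (rule mat_eq_of_diff_zero[rotated 2]) simp
  then show ?thesis using that by blast
qed

lemma sum_translate:
  fixes G (structure) and f :: "'a \<Rightarrow> 'c::comm_monoid_add"
  assumes "group G" "h \<in> carrier G"
  shows "(\<Sum>g\<in>carrier G. f (h \<otimes> g)) = (\<Sum>g\<in>carrier G. f g)"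
proof -
  interpret group G by fact
  show ?thesis using assms(2)
    by (intro sum.reindex_bij_witness[of _ "\<lambda>g. inv h \<otimes> g" "\<lambda>g. h \<otimes> g"]) (auto simp flip: m_assoc)
qed

text \<open>
  \<open>B\<close> is the sum \<open>\<Sum>\<^sub>g \<sigma>(g) E\<^sub>j\<^sub>k \<rho>(g\<^sup>-\<^sup>1)\<close> of an elementary matrix \<open>E\<^sub>j\<^sub>k\<close>, written in coordinates;
  translating the summation variable by \<open>h\<close> moves \<open>\<sigma>(h)\<close> across it.
\<close>

lemma sum_matrix_coefficients_intertwines:
  fixes G (structure)
  assumes G: "group G"
    and \<rho>: "continuous_representation G T d \<rho>"
    and \<sigma>: "continuous_representation G T e \<sigma>"
    and jk: "j < e" "k < d" and h: "h \<in> carrier G"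
  defines "B \<equiv> mat e d (\<lambda>(i, l). \<Sum>g\<in>carrier G. \<sigma> g $$ (i, j) * \<rho> (inv g) $$ (k, l))"
  shows "\<sigma> h * B = B * \<rho> h"
proof (rule eq_matI)
  interpret group G by fact
  note r = continuous_representationD[OF G \<rho>] and s = continuous_representationD[OF G \<sigma>]
  have B: "B \<in> carrier_mat e d" by (simp add: B_def)
  show "dim_row (\<sigma> h * B) = dim_row (B * \<rho> h)" "dim_col (\<sigma> h * B) = dim_col (B * \<rho> h)"
    using r(1)[OF h] s(1)[OF h] B by auto
  fix i l assume "i < dim_row (B * \<rho> h)" "l < dim_col (B * \<rho> h)"
  then have il: "i < e" "l < d" using B r(1)[OF h] by auto
  have "(\<sigma> h * B) $$ (i, l) = (\<Sum>m<e. \<Sum>g\<in>carrier G. \<sigma> h $$ (i, m) * \<sigma> g $$ (m, j) * \<rho> (inv g) $$ (k, l))"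
    unfolding mat_mult_entry[OF s(1)[OF h] B il] using il
    by (auto simp: B_def sum_distrib_left mult.assoc)
  also have "\<dots> = (\<Sum>g\<in>carrier G. \<sigma> (h \<otimes> g) $$ (i, j) * \<rho> (inv g) $$ (k, l))"
    by (subst sum.swap, intro sum.cong refl)
      (simp add: s(3) h mat_mult_entry[OF s(1)[OF h] s(1) il(1) jk(1)] sum_distrib_right)
  also have "\<dots> = (\<Sum>g\<in>carrier G. \<sigma> (h \<otimes> g) $$ (i, j) * \<rho> (inv (h \<otimes> g) \<otimes> h) $$ (k, l))"
  proof (intro sum.cong refl)
    fix g assume "g \<in> carrier G"
    then have "inv (h \<otimes> g) \<otimes> h = inv g" using h by (simp add: inv_mult_group m_assoc)
    then show "\<sigma> (h \<otimes> g) $$ (i, j) * \<rho> (inv g) $$ (k, l) =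
        \<sigma> (h \<otimes> g) $$ (i, j) * \<rho> (inv (h \<otimes> g) \<otimes> h) $$ (k, l)" by simp
  qed
  also have "\<dots> = (\<Sum>g\<in>carrier G. \<sigma> g $$ (i, j) * \<rho> (inv g \<otimes> h) $$ (k, l))"
    by (rule sum_translate[OF G h])
  also have "\<dots> = (\<Sum>m<d. \<Sum>g\<in>carrier G. \<sigma> g $$ (i, j) * \<rho> (inv g) $$ (k, m) * \<rho> h $$ (m, l))"
    by (subst sum.swap, intro sum.cong refl)
      (simp add: r(3) h mat_mult_entry[OF r(1) r(1)[OF h] jk(2) il(2)] sum_distrib_left mult.assoc)
  also have "\<dots> = (B * \<rho> h) $$ (i, l)"
    unfolding mat_mult_entry[OF B r(1)[OF h] il] using il
    by (auto simp: B_def sum_distrib_right)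
  finally show "(\<sigma> h * B) $$ (i, l) = (B * \<rho> h) $$ (i, l)" .
qed

lemma matrix_coefficients_orthogonal:
  fixes G (structure)
  assumes G: "group G"
    and \<rho>: "continuous_representation G T d \<rho>" "irreducible_representation G d \<rho>"
    and \<sigma>: "continuous_representation G T e \<sigma>" "irreducible_representation G e \<sigma>"
    and idx: "i < e" "j < e" "k < d" "l < d"
    and diff: "g0 \<in> carrier G" "mat_trace (\<sigma> g0) \<noteq> mat_trace (\<rho> g0)"
  shows "(\<Sum>g\<in>carrier G. \<sigma> g $$ (i, j) * \<rho> (inv g) $$ (k, l)) = 0"
proof -
  define B where "B = mat e d (\<lambda>(i, l). \<Sum>g\<in>carrier G. \<sigma> g $$ (i, j) * \<rho> (inv g) $$ (k, l))"
  have "B \<in> carrier_mat e d" by (simp add: B_def)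
  from intertwiner_zero_or_same_trace[OF G \<rho> \<sigma> this]
    sum_matrix_coefficients_intertwines[OF G \<rho>(1) \<sigma>(1) idx(2,3)] diff
  have "B = 0\<^sub>m e d" unfolding B_def by blast
  then have "B $$ (i, l) = 0\<^sub>m e d $$ (i, l)" by simp
  then show ?thesis using idx by (simp add: B_def)
qed

text \<open>
  Here the summed matrix is a scalar \<open>c\<close>, found by comparing traces: \<open>d c\<close> is the sum over \<open>g\<close> of
  the \<open>(k, j)\<close> entries of \<open>\<rho>(g\<^sup>-\<^sup>1) \<rho>(g) = 1\<close>.
\<close>

lemma matrix_coefficients_self_orthogonality:
  fixes G (structure)
  assumes G: "group G"
    and \<rho>: "continuous_representation G T d \<rho>" "irreducible_representation G d \<rho>"
    and idx: "i < d" "j < d" "k < d" "l < d"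
  shows "(\<Sum>g\<in>carrier G. \<rho> g $$ (i, j) * \<rho> (inv g) $$ (k, l)) =
    (if j = k then if i = l then of_nat (order G) / of_nat d else 0 else 0)"
proof -
  interpret group G by fact
  note r = continuous_representationD[OF G \<rho>(1)]
  define B where "B = mat d d (\<lambda>(i, l). \<Sum>g\<in>carrier G. \<rho> g $$ (i, j) * \<rho> (inv g) $$ (k, l))"
  have "B \<in> carrier_mat d d" by (simp add: B_def)
  from commutant_scalar[OF G \<rho> this]
    sum_matrix_coefficients_intertwines[OF G \<rho>(1) \<rho>(1) idx(2,3)]
  obtain c where c: "B = c \<cdot>\<^sub>m 1\<^sub>m d" unfolding B_def by blast
  have "of_nat d * c = mat_trace B" by (simp add: c mat_trace_def)
  also have "\<dots> = (\<Sum>i<d. \<Sum>g\<in>carrier G. \<rho> (inv g) $$ (k, i) * \<rho> g $$ (i, j))"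
    by (simp add: B_def mat_trace_def mult.commute)
  also have "\<dots> = (\<Sum>g\<in>carrier G. \<rho> (inv g \<otimes> g) $$ (k, j))"
  proof (subst sum.swap, intro sum.cong refl)
    fix g assume g: "g \<in> carrier G"
    show "(\<Sum>i<d. \<rho> (inv g) $$ (k, i) * \<rho> g $$ (i, j)) = \<rho> (inv g \<otimes> g) $$ (k, j)"
      unfolding r(3)[OF inv_closed[OF g] g]
      by (rule mat_mult_entry[OF r(1)[OF inv_closed[OF g]] r(1)[OF g] idx(3,2), symmetric])
  qed
  also have "\<dots> = (if j = k then of_nat (order G) else 0)"
    using idx r(2) by (simp add: order_def)
  finally have "c = (if j = k then of_nat (order G) / of_nat d else 0)"
    using idx by (auto simp: field_simps)
  moreover have "B $$ (i, l) = (c \<cdot>\<^sub>m 1\<^sub>m d) $$ (i, l)" using c by simp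
  ultimately show ?thesis using idx by (simp add: B_def)
qed

section \<open>Frobenius' formula for products of commutators\<close>

lemma IrrE:
  assumes "\<psi> \<in> Irr G T"
  obtains d \<rho> where "continuous_representation G T d \<rho>" "irreducible_representation G d \<rho>"
    "d > 0" "\<psi> = (\<lambda>g\<in>carrier G. mat_trace (\<rho> g))"
  using assms unfolding Irr_def irreducible_representation_def by auto

lemma character_eq_sum_diag:
  fixes G (structure)
  assumes "group G" "continuous_representation G T d \<rho>" "\<psi> = (\<lambda>g\<in>carrier G. mat_trace (\<rho> g))"
    and g: "g \<in> carrier G"
  shows "\<psi> g = (\<Sum>i<d. \<rho> g $$ (i, i))"
  using continuous_representationD(1)[OF assms(1,2) g] g assms(3) by (auto simp: mat_trace_def)

lemma character_one:
  fixes G (structure)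
  assumes "group G" "continuous_representation G T d \<rho>" "\<psi> = (\<lambda>g\<in>carrier G. mat_trace (\<rho> g))"
  shows "\<psi> \<one> = of_nat d"
proof -
  interpret group G by fact
  show ?thesis
    using character_eq_sum_diag[OF assms one_closed] continuous_representationD(2)[OF assms(1,2)] by simp
qed

lemma Irr_degree:
  fixes G (structure)
  assumes "group G" "\<psi> \<in> Irr G T"
  obtains d where "d > 0" "\<psi> \<one> = of_nat d"
  using assms character_one by (metis IrrE)

lemma sum_double_delta:
  fixes c :: complex
  assumes "i < d" "j < (d::nat)"
  shows "(\<Sum>k<d. \<Sum>l<d. (if j = k then if i = l then c else 0 else 0) * F k l) = c * F j i"
proof -
  have "(\<Sum>l<d. (if j = k then if i = l then c else 0 else 0) * F k l) = (if j = k then c * F k i else 0)" for k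
    using assms by (auto simp: if_distrib[of "\<lambda>u. u * _"] cong: if_cong)
  then show ?thesis using assms by simp
qed

lemma sum_list_eq_sum_count_list:
  fixes f :: "'a \<Rightarrow> 'b::comm_semiring_1"
  assumes "finite A" "set xs \<subseteq> A"
  shows "(\<Sum>x\<leftarrow>xs. f x) = (\<Sum>x\<in>A. of_nat (count_list xs x) * f x)"
  using assms(2)
proof (induction xs)
  case (Cons a xs)
  have "(\<Sum>x\<in>A. of_nat (count_list (a # xs) x) * f x)
      = (\<Sum>x\<in>A. (if a = x then f x else 0) + of_nat (count_list xs x) * f x)"
    by (intro sum.cong) (auto simp: algebra_simps)
  then show ?case using Cons assms(1) by (simp add: sum.distrib)
qed simp

text \<open>
  The product is bracketed to the right so that its character expands directly into the matrix
  coefficients of \<open>x\<close> and \<open>x\<^sup>-\<^sup>1\<close>, whose sums over \<open>x\<close> are known.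
\<close>

lemma irreducible_character_conjugation_sum:
  fixes G (structure)
  assumes G: "group G" and \<psi>: "\<psi> \<in> Irr G T"
    and y: "y \<in> carrier G" and z: "z \<in> carrier G"
  shows "(\<Sum>x\<in>carrier G. \<psi> (x \<otimes> (y \<otimes> (inv x \<otimes> z)))) = of_nat (order G) / \<psi> \<one> * \<psi> y * \<psi> z"
proof -
  interpret group G by fact
  obtain d \<rho> where \<rho>: "continuous_representation G T d \<rho>" "irreducible_representation G d \<rho>"
    and d: "d > 0" and \<psi>_eq: "\<psi> = (\<lambda>g\<in>carrier G. mat_trace (\<rho> g))"
    using IrrE[OF \<psi>] .
  note r = continuous_representationD[OF G \<rho>(1)]
  note diag = character_eq_sum_diag[OF G \<rho>(1) \<psi>_eq]
  have entry: "\<rho> (a \<otimes> b) $$ (i, j) = (\<Sum>l<d. \<rho> a $$ (i, l) * \<rho> b $$ (l, j))"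
    if "a \<in> carrier G" "b \<in> carrier G" "i < d" "j < d" for a b i j
    using mat_mult_entry[OF r(1)[OF that(1)] r(1)[OF that(2)] that(3,4)] r(3)[OF that(1,2)] by simp
  have "(\<Sum>x\<in>carrier G. \<psi> (x \<otimes> (y \<otimes> (inv x \<otimes> z)))) =
     (\<Sum>x\<in>carrier G. \<Sum>i<d. \<Sum>j<d. \<Sum>k<d. \<Sum>l<d.
        \<rho> x $$ (i, j) * \<rho> (inv x) $$ (k, l) * (\<rho> y $$ (j, k) * \<rho> z $$ (l, i)))"
    using y z by (intro sum.cong refl) (simp add: diag entry sum_distrib_left mult_ac)
  also have "\<dots> = (\<Sum>i<d. \<Sum>j<d. \<Sum>k<d. \<Sum>l<d.
        (\<Sum>x\<in>carrier G. \<rho> x $$ (i, j) * \<rho> (inv x) $$ (k, l)) * (\<rho> y $$ (j, k) * \<rho> z $$ (l, i)))"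
    unfolding sum.swap[of _ _ "carrier G"] sum_distrib_right ..
  also have "\<dots> = (\<Sum>i<d. \<Sum>j<d. of_nat (order G) / of_nat d * (\<rho> y $$ (j, j) * \<rho> z $$ (i, i)))"
    by (intro sum.cong refl) (simp add: matrix_coefficients_self_orthogonality[OF G \<rho>] sum_double_delta)
  also have "\<dots> = of_nat (order G) / of_nat d * ((\<Sum>i<d. \<rho> z $$ (i, i)) * (\<Sum>j<d. \<rho> y $$ (j, j)))"
    unfolding sum_product by (simp add: sum_distrib_left mult.commute)
  finally show ?thesis using character_one[OF G \<rho>(1) \<psi>_eq] diag y z by simp
qed

lemma irreducible_character_convolution:
  fixes G (structure)
  assumes G: "group G" and \<psi>: "\<psi> \<in> Irr G T" and \<phi>: "\<phi> \<in> Irr G T"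
    and z: "z \<in> carrier G"
  shows "(\<Sum>y\<in>carrier G. \<phi> y * \<psi> (inv y \<otimes> z)) =
    (if \<phi> = \<psi> then of_nat (order G) / \<psi> \<one> * \<psi> z else 0)"
proof -
  interpret group G by fact
  obtain d \<rho> where \<rho>: "continuous_representation G T d \<rho>" "irreducible_representation G d \<rho>"
    and d: "d > 0" and \<psi>_eq: "\<psi> = (\<lambda>g\<in>carrier G. mat_trace (\<rho> g))"
    using IrrE[OF \<psi>] .
  note r = continuous_representationD[OF G \<rho>(1)]
  note diag = character_eq_sum_diag[OF G \<rho>(1) \<psi>_eq]
  have entry: "\<rho> (a \<otimes> b) $$ (i, j) = (\<Sum>l<d. \<rho> a $$ (i, l) * \<rho> b $$ (l, j))"
    if "a \<in> carrier G" "b \<in> carrier G" "i < d" "j < d" for a b i j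
    using mat_mult_entry[OF r(1)[OF that(1)] r(1)[OF that(2)] that(3,4)] r(3)[OF that(1,2)] by simp
  have expand: "(\<Sum>y\<in>carrier G. \<phi> y * \<psi> (inv y \<otimes> z)) = (\<Sum>i<e. \<Sum>k<d. \<Sum>l<d.
      (\<Sum>y\<in>carrier G. \<sigma> y $$ (i, i) * \<rho> (inv y) $$ (k, l)) * \<rho> z $$ (l, k))"
    if "continuous_representation G T e \<sigma>" "\<phi> = (\<lambda>g\<in>carrier G. mat_trace (\<sigma> g))" for e \<sigma>
  proof -
    have "(\<Sum>y\<in>carrier G. \<phi> y * \<psi> (inv y \<otimes> z)) = (\<Sum>y\<in>carrier G. \<Sum>i<e. \<Sum>k<d. \<Sum>l<d.
        \<sigma> y $$ (i, i) * \<rho> (inv y) $$ (k, l) * \<rho> z $$ (l, k))"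
    proof (intro sum.cong refl)
      fix y assume y: "y \<in> carrier G"
      have "\<phi> y * \<psi> (inv y \<otimes> z) = (\<Sum>i<e. \<sigma> y $$ (i, i) * \<psi> (inv y \<otimes> z))"
        using character_eq_sum_diag[OF G that y] by (simp add: sum_distrib_right)
      also have "\<dots> = (\<Sum>i<e. \<Sum>k<d. \<Sum>l<d. \<sigma> y $$ (i, i) * \<rho> (inv y) $$ (k, l) * \<rho> z $$ (l, k))"
        using y z by (simp add: diag entry sum_distrib_left mult.assoc)
      finally show "\<phi> y * \<psi> (inv y \<otimes> z) =
          (\<Sum>i<e. \<Sum>k<d. \<Sum>l<d. \<sigma> y $$ (i, i) * \<rho> (inv y) $$ (k, l) * \<rho> z $$ (l, k))" .
    qed
    also have "\<dots> = (\<Sum>i<e. \<Sum>k<d. \<Sum>l<d.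
        (\<Sum>y\<in>carrier G. \<sigma> y $$ (i, i) * \<rho> (inv y) $$ (k, l)) * \<rho> z $$ (l, k))"
      unfolding sum.swap[of _ _ "carrier G"] sum_distrib_right ..
    finally show ?thesis .
  qed
  show ?thesis
  proof (cases "\<phi> = \<psi>")
    case True
    have "(\<Sum>y\<in>carrier G. \<phi> y * \<psi> (inv y \<otimes> z)) = (\<Sum>i<d. of_nat (order G) / of_nat d * \<rho> z $$ (i, i))"
      unfolding expand[OF \<rho>(1) trans[OF True \<psi>_eq]]
      by (intro sum.cong refl)
        (simp add: matrix_coefficients_self_orthogonality[OF G \<rho>] sum_double_delta[of _ _ _ _ "\<lambda>k l. \<rho> z $$ (l, k)"])
    then show ?thesis
      using True character_one[OF G \<rho>(1) \<psi>_eq] diag z by (simp add: sum_distrib_left)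
  next
    case False
    obtain e \<sigma> where \<sigma>: "continuous_representation G T e \<sigma>" "irreducible_representation G e \<sigma>"
      and \<phi>_eq: "\<phi> = (\<lambda>g\<in>carrier G. mat_trace (\<sigma> g))"
      using IrrE[OF \<phi>] .
    obtain g0 where "g0 \<in> carrier G" "mat_trace (\<sigma> g0) \<noteq> mat_trace (\<rho> g0)"
      using False unfolding \<phi>_eq \<psi>_eq by (metis restrict_ext)
    from matrix_coefficients_orthogonal[OF G \<rho> \<sigma> _ _ _ _ this] show ?thesis
      unfolding expand[OF \<sigma>(1) \<phi>_eq] using False by simp
  qed
qed

text \<open>
  Left multiplication permutes the group, and only the identity has a fixed point. Continuity is
  automatic as singletons are open.
\<close>

lemma regular_representation:
  fixes G (structure)
  assumes G: "group G" and fin: "finite (carrier G)" and top: "topspace T = carrier G"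
    and open_points: "\<And>g. g \<in> carrier G \<Longrightarrow> openin T {g}"
  shows "\<exists>\<rho>. continuous_representation G T (order G) \<rho> \<and>
    (\<forall>g\<in>carrier G. mat_trace (\<rho> g) = (if g = \<one> then of_nat (order G) else 0))"
proof -
  interpret group G by fact
  define m where "m = order G"
  obtain e where e: "bij_betw e {..<m} (carrier G)"
    using ex_bij_betw_nat_finite[OF fin] by (auto simp: m_def order_def atLeast0LessThan)
  have ec: "e i \<in> carrier G" if "i < m" for i using e that by (auto simp: bij_betw_def)
  have einj: "e i = e j \<longleftrightarrow> i = j" if "i < m" "j < m" for i j
    using e that by (auto simp: bij_betw_def inj_on_def)
  \<comment> \<open>The permutation matrix of left multiplication by \<open>g\<close>, in the enumeration \<open>e\<close>.\<close>
  define \<rho> where "\<rho> = (\<lambda>g. mat m m (\<lambda>(i, j). if e i = g \<otimes> e j then 1 else 0 :: complex))"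
  have "continuous_representation G T m \<rho>"
  proof (rule continuous_representationI[OF G])
    show "\<rho> \<one> = 1\<^sub>m m" using ec einj by (intro eq_matI) (auto simp: \<rho>_def)
    fix g h assume g: "g \<in> carrier G" and h: "h \<in> carrier G"
    show "\<rho> (g \<otimes> h) = \<rho> g * \<rho> h"
    proof (rule eq_matI)
      fix i j assume "i < dim_row (\<rho> g * \<rho> h)" "j < dim_col (\<rho> g * \<rho> h)"
      then have ij: "i < m" "j < m" by (auto simp: \<rho>_def)
      obtain l0 where l0: "l0 < m" "e l0 = h \<otimes> e j"
        using e h ec[OF ij(2)] unfolding bij_betw_def by (metis imageE lessThan_iff m_closed)
      have "(\<rho> g * \<rho> h) $$ (i, j) = (\<Sum>l<m. \<rho> g $$ (i, l) * \<rho> h $$ (l, j))"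
        using ij by (intro mat_mult_entry[of _ m m]) (auto simp: \<rho>_def)
      also have "\<dots> = (\<Sum>l<m. if l = l0 then \<rho> g $$ (i, l0) else 0)"
        using ij l0(1) by (intro sum.cong refl) (auto simp: \<rho>_def l0(2)[symmetric] einj)
      also have "\<dots> = \<rho> g $$ (i, l0)" using l0 by simp
      also have "\<dots> = \<rho> (g \<otimes> h) $$ (i, j)"
        using ij l0 g h ec by (simp add: \<rho>_def m_assoc)
      finally show "\<rho> (g \<otimes> h) $$ (i, j) = (\<rho> g * \<rho> h) $$ (i, j)" by simp
    qed (auto simp: \<rho>_def)
  next
    fix i j assume "i < m" "j < m"
    have "openin T U" if "U \<subseteq> carrier G" for U
    proof -
      have "openin T (\<Union>g\<in>U. {g})" using open_points that by (intro openin_Union) auto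
      then show ?thesis by simp
    qed
    then show "continuous_map T euclidean (\<lambda>g. \<rho> g $$ (i, j))"
      unfolding continuous_map_def using top by auto
  qed (auto simp: \<rho>_def)
  moreover have "mat_trace (\<rho> g) = (if g = \<one> then of_nat m else 0)" if g: "g \<in> carrier G" for g
  proof -
    have "e i = g \<otimes> e i \<longleftrightarrow> g = \<one>" if "i < m" for i
      using g ec[OF that] r_cancel_one by auto
    then have "mat_trace (\<rho> g) = (\<Sum>i<m. if g = \<one> then 1 else 0)"
      by (auto simp: mat_trace_def \<rho>_def intro!: sum.cong)
    then show ?thesis by simp
  qed
  ultimately show ?thesis unfolding m_def by blast
qed

text \<open>
  Convolving \<open>|G| \<delta>\<^sub>1 = \<Sum> m\<^sub>\<psi> \<psi>\<close> with any irreducible \<open>\<phi>\<close> gives \<open>m\<^sub>\<phi> = \<phi>(1)\<close>. As \<open>\<phi>(1) \<noteq> 0\<close>, every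
  irreducible character occurs in the regular one, which shows at the same time that there are only
  finitely many.
\<close>

lemma regular_character_decomposition:
  fixes G (structure)
  assumes G: "group G" and fin: "finite (carrier G)"
  defines "T \<equiv> discrete_topology (carrier G)"
  shows finite_Irr_finite_group: "finite (Irr G T)"
    and "g \<in> carrier G \<Longrightarrow> (\<Sum>\<psi>\<in>Irr G T. \<psi> \<one> * \<psi> g) = (if g = \<one> then of_nat (order G) else 0)"
proof -
  interpret group G by fact
  have ordpos: "order G > 0" using fin by (simp add: order_gt_0_iff_finite)
  obtain \<rho> where \<rho>: "continuous_representation G T (order G) \<rho>"
    and tr: "\<forall>g\<in>carrier G. mat_trace (\<rho> g) = (if g = \<one> then of_nat (order G) else 0)"
    using regular_representation[OF G fin, of T] by (auto simp: T_def)
  obtain xs where xs: "set xs \<subseteq> Irr G T" "\<forall>g\<in>carrier G. mat_trace (\<rho> g) = (\<Sum>\<psi>\<leftarrow>xs. \<psi> g)"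
    using character_sum_of_irreducible[OF G _ \<rho>] by (auto simp: T_def)
  have reg: "(if g = \<one> then of_nat (order G) else 0) = (\<Sum>\<psi>\<in>set xs. of_nat (count_list xs \<psi>) * \<psi> g)"
    if "g \<in> carrier G" for g
    using tr xs(2) that sum_list_eq_sum_count_list[of "set xs" xs "\<lambda>\<psi>. \<psi> g"] by simp
  have mult: "of_nat (count_list xs \<phi>) = \<phi> \<one>" if \<phi>: "\<phi> \<in> Irr G T" for \<phi>
  proof -
    obtain d where d: "d > 0" "\<phi> \<one> = of_nat d" using Irr_degree[OF G \<phi>] .
    have "(\<Sum>y\<in>carrier G. (if y = \<one> then of_nat (order G) else 0) * \<phi> (inv y \<otimes> \<one>)) =
        (\<Sum>y\<in>carrier G. if y = \<one> then of_nat (order G) * \<phi> \<one> else 0)"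
      by (intro sum.cong refl) auto
    also have "\<dots> = of_nat (order G) * \<phi> \<one>" using fin by simp
    finally have "of_nat (order G) * \<phi> \<one> =
        (\<Sum>y\<in>carrier G. (if y = \<one> then of_nat (order G) else 0) * \<phi> (inv y \<otimes> \<one>))" by simp
    also have "\<dots> = (\<Sum>y\<in>carrier G. \<Sum>\<psi>\<in>set xs. of_nat (count_list xs \<psi>) * (\<psi> y * \<phi> (inv y \<otimes> \<one>)))"
      by (intro sum.cong refl) (simp only: reg sum_distrib_right mult.assoc)
    also have "\<dots> = (\<Sum>\<psi>\<in>set xs. of_nat (count_list xs \<psi>) * (\<Sum>y\<in>carrier G. \<psi> y * \<phi> (inv y \<otimes> \<one>)))"
      by (subst sum.swap) (simp only: sum_distrib_left)
    also have "\<dots> = (\<Sum>\<psi>\<in>set xs. if \<psi> = \<phi> then of_nat (count_list xs \<phi>) * of_nat (order G) else 0)"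
      using irreducible_character_convolution[OF G \<phi> _ one_closed] xs(1) d
      by (intro sum.cong refl) auto
    also have "\<dots> = of_nat (count_list xs \<phi>) * of_nat (order G)"
      by (cases "\<phi> \<in> set xs") (auto simp: count_list_0_iff)
    finally show ?thesis using ordpos by (simp add: mult.commute)
  qed
  have "\<phi> \<in> set xs" if "\<phi> \<in> Irr G T" for \<phi>
    using mult[OF that] Irr_degree[OF G that] by (metis count_list_0_iff less_numeral_extra(3) of_nat_eq_iff)
  then have Irr_eq: "Irr G T = set xs" using xs(1) by blast
  then show "finite (Irr G T)" by simp
  show "(\<Sum>\<psi>\<in>Irr G T. \<psi> \<one> * \<psi> g) = (if g = \<one> then of_nat (order G) else 0)" if "g \<in> carrier G"
    unfolding reg[OF that] Irr_eq using mult Irr_eq by (intro sum.cong refl) auto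
qed

lemma sum_PiE_Suc:
  fixes F :: "(nat \<Rightarrow> 'a) \<Rightarrow> 'b::comm_monoid_add"
  shows "(\<Sum>z\<in>PiE {..<Suc m} (\<lambda>_. A). F z) = (\<Sum>z\<in>PiE {..<m} (\<lambda>_. A). \<Sum>a\<in>A. F (z(m := a)))"
proof -
  have "(\<Sum>z\<in>PiE {..<m} (\<lambda>_. A). \<Sum>a\<in>A. F (z(m := a))) = (\<Sum>(z, a)\<in>PiE {..<m} (\<lambda>_. A) \<times> A. F (z(m := a)))"
    by (simp add: sum.cartesian_product)
  also have "\<dots> = (\<Sum>z\<in>PiE {..<Suc m} (\<lambda>_. A). F z)"
  proof (rule sum.reindex_bij_witness[of _ "\<lambda>z. (z(m := undefined), z m)" "\<lambda>(z, a). z(m := a)"])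
    fix p assume p: "p \<in> PiE {..<m} (\<lambda>_. A) \<times> A"
    obtain z a where za: "p = (z, a)" "z \<in> PiE {..<m} (\<lambda>_. A)" "a \<in> A" using p by blast
    have "z m = undefined" using za(2) by (rule PiE_arb) simp
    then have "(z(m := a))(m := undefined) = z" by auto
    then show "(\<lambda>z. (z(m := undefined), z m)) (case p of (z, a) \<Rightarrow> z(m := a)) = p" using za by simp
    have "z(m := a) \<in> PiE (insert m {..<m}) (\<lambda>_. A)" using za by (intro PiE_fun_upd)
    then show "(case p of (z, a) \<Rightarrow> z(m := a)) \<in> PiE {..<Suc m} (\<lambda>_. A)"
      unfolding za(1) lessThan_Suc prod.case .
    show "F (case p of (z, a) \<Rightarrow> z(m := a)) = (case p of (z, a) \<Rightarrow> F (z(m := a)))" using za by simp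
  next
    fix z assume z: "z \<in> PiE {..<Suc m} (\<lambda>_. A)"
    show "(case (z(m := undefined), z m) of (z, a) \<Rightarrow> z(m := a)) = z" by simp
    have "z(m := undefined) \<in> PiE {..<m} (\<lambda>_. A)"
    proof (rule PiE_I)
      show "(z(m := undefined)) i \<in> A" if "i \<in> {..<m}" for i
        using PiE_mem[OF z, of i] that by simp
      show "(z(m := undefined)) i = undefined" if "i \<notin> {..<m}" for i
        using PiE_arb[OF z, of i] that by (cases "i = m") auto
    qed
    moreover have "z m \<in> A" using PiE_mem[OF z, of m] by simp
    ultimately show "(z(m := undefined), z m) \<in> PiE {..<m} (\<lambda>_. A) \<times> A" by blast
  qed
  finally show ?thesis by simp
qed

lemma group_commutator_closed:
  fixes G (structure)
  assumes "group G" "x \<in> carrier G" "y \<in> carrier G"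
  shows "group_commutator G x y \<in> carrier G"
proof -
  interpret group G by fact
  show ?thesis using assms by (simp add: group_commutator_def)
qed

lemma commutator_map_closed:
  fixes G (structure)
  assumes "group G" "\<And>i. i < 2 * k \<Longrightarrow> z i \<in> carrier G"
  shows "commutator_map G k z \<in> carrier G"
proof -
  interpret group G by fact
  show ?thesis using assms(2)
    by (induction k) (auto simp: group_commutator_closed[OF assms(1)])
qed

lemma commutator_map_cong:
  assumes "\<And>i. i < 2 * k \<Longrightarrow> z i = z' i"
  shows "commutator_map G k z = commutator_map G k z'"
  using assms by (induction k) auto

text \<open>
  \<open>[x, y]\<^sup>-\<^sup>1 h = y (x (y\<^sup>-\<^sup>1 (x\<^sup>-\<^sup>1 h)))\<close>: the sum over \<open>y\<close> is a conjugation sum at \<open>x\<close>, and what is left is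
  a convolution of \<open>\<psi>\<close> with itself. The inverse of the commutator is used so that in the end
  \<open>\<psi>(h)\<close> appears in Frobenius' formula, and not \<open>\<psi>(h\<^sup>-\<^sup>1)\<close>.
\<close>

lemma irreducible_character_commutator_sum:
  fixes G (structure)
  assumes G: "group G" and \<psi>: "\<psi> \<in> Irr G T" and h: "h \<in> carrier G"
  shows "(\<Sum>x\<in>carrier G. \<Sum>y\<in>carrier G. \<psi> (inv (group_commutator G x y) \<otimes> h)) =
    (of_nat (order G) / \<psi> \<one>)\<^sup>2 * \<psi> h"
proof -
  interpret group G by fact
  have "(\<Sum>x\<in>carrier G. \<Sum>y\<in>carrier G. \<psi> (inv (group_commutator G x y) \<otimes> h)) =
      (\<Sum>x\<in>carrier G. \<Sum>y\<in>carrier G. \<psi> (y \<otimes> (x \<otimes> (inv y \<otimes> (inv x \<otimes> h)))))"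
    using h by (intro sum.cong refl) (simp add: group_commutator_def inv_mult_group m_assoc)
  also have "\<dots> = (\<Sum>x\<in>carrier G. of_nat (order G) / \<psi> \<one> * (\<psi> x * \<psi> (inv x \<otimes> h)))"
    using h by (intro sum.cong refl) (simp add: irreducible_character_conjugation_sum[OF G \<psi>])
  also have "\<dots> = of_nat (order G) / \<psi> \<one> * (of_nat (order G) / \<psi> \<one> * \<psi> h)"
    unfolding sum_distrib_left[symmetric] using irreducible_character_convolution[OF G \<psi> \<psi> h] by simp
  finally show ?thesis by (simp add: power2_eq_square mult.assoc)
qed

text \<open>
  Inverting reverses the product of commutators, so the last pair of variables comes first and can
  be summed before the others; each pair contributes the same scalar.
\<close>

lemma irreducible_character_commutator_map_sum:
  fixes G (structure)
  assumes G: "group G" and \<psi>: "\<psi> \<in> Irr G T" and h: "h \<in> carrier G"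
  shows "(\<Sum>z\<in>PiE {..<2 * k} (\<lambda>_. carrier G). \<psi> (inv (commutator_map G k z) \<otimes> h)) =
    (of_nat (order G) / \<psi> \<one>) ^ (2 * k) * \<psi> h"
proof (induction k)
  case 0
  interpret group G by fact
  show ?case using h by simp
next
  case (Suc k)
  interpret group G by fact
  have idx: "{..<2 * Suc k} = {..<Suc (Suc (2 * k))}" by simp
  have "(\<Sum>z\<in>PiE {..<2 * Suc k} (\<lambda>_. carrier G). \<psi> (inv (commutator_map G (Suc k) z) \<otimes> h)) =
    (\<Sum>z\<in>PiE {..<2 * k} (\<lambda>_. carrier G). \<Sum>x\<in>carrier G. \<Sum>y\<in>carrier G.
       \<psi> (inv (group_commutator G x y) \<otimes> (inv (commutator_map G k z) \<otimes> h)))"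
    unfolding idx sum_PiE_Suc
  proof (intro sum.cong refl)
    fix z x y assume z: "z \<in> PiE {..<2 * k} (\<lambda>_. carrier G)" and xy: "x \<in> carrier G" "y \<in> carrier G"
    let ?z = "z(2 * k := x, Suc (2 * k) := y)"
    have "commutator_map G k ?z = commutator_map G k z" by (intro commutator_map_cong) auto
    moreover have "commutator_map G k z \<in> carrier G" using z by (intro commutator_map_closed[OF G]) auto
    ultimately show "\<psi> (inv (commutator_map G (Suc k) ?z) \<otimes> h) =
        \<psi> (inv (group_commutator G x y) \<otimes> (inv (commutator_map G k z) \<otimes> h))"
      using xy h group_commutator_closed[OF G xy] by (simp add: inv_mult_group m_assoc)
  qed
  also have "\<dots> = (\<Sum>z\<in>PiE {..<2 * k} (\<lambda>_. carrier G).
      (of_nat (order G) / \<psi> \<one>)\<^sup>2 * \<psi> (inv (commutator_map G k z) \<otimes> h))"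
  proof (intro sum.cong refl)
    fix z assume "z \<in> PiE {..<2 * k} (\<lambda>_. carrier G)"
    then have "commutator_map G k z \<in> carrier G" by (intro commutator_map_closed[OF G]) auto
    then have "inv (commutator_map G k z) \<otimes> h \<in> carrier G" using h by simp
    from irreducible_character_commutator_sum[OF G \<psi> this]
    show "(\<Sum>x\<in>carrier G. \<Sum>y\<in>carrier G.
       \<psi> (inv (group_commutator G x y) \<otimes> (inv (commutator_map G k z) \<otimes> h))) =
       (of_nat (order G) / \<psi> \<one>)\<^sup>2 * \<psi> (inv (commutator_map G k z) \<otimes> h)" .
  qed
  also have "\<dots> = (of_nat (order G) / \<psi> \<one>) ^ (2 * Suc k) * \<psi> h"
    unfolding sum_distrib_left[symmetric] Suc.IH by (simp add: power2_eq_square mult_ac)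
  finally show ?case .
qed

text \<open>
  \<open>\<Phi>(z) = h\<close> is detected by the regular character at \<open>\<Phi>(z)\<^sup>-\<^sup>1 h\<close>; expanding it into irreducible
  characters leaves sums that are already evaluated.
\<close>

theorem frobenius_commutator_count:
  fixes G (structure)
  assumes G: "group G" and fin: "finite (carrier G)" and h: "h \<in> carrier G" and n: "n > 0"
  shows "of_nat (card {z \<in> PiE {..<2 * n} (\<lambda>_. carrier G). commutator_map G n z = h}) =
    of_nat (order G) ^ (2 * n - 1) *
      (\<Sum>\<psi>\<in>Irr G (discrete_topology (carrier G)). \<psi> h / \<psi> \<one> ^ (2 * n - 1))"
proof -
  interpret group G by fact
  let ?I = "Irr G (discrete_topology (carrier G))"
  let ?P = "PiE {..<2 * n} (\<lambda>_. carrier G)"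
  have ordpos: "order G > 0" using fin by (simp add: order_gt_0_iff_finite)
  have finP: "finite ?P" using fin by (intro finite_PiE) auto
  have "of_nat (order G) * of_nat (card {z \<in> ?P. commutator_map G n z = h}) =
      (\<Sum>z\<in>?P. if commutator_map G n z = h then of_nat (order G) else 0 :: complex)"
    using finP by (simp add: sum.If_cases Int_def)
  also have "\<dots> = (\<Sum>z\<in>?P. \<Sum>\<psi>\<in>?I. \<psi> \<one> * \<psi> (inv (commutator_map G n z) \<otimes> h))"
  proof (intro sum.cong refl)
    fix z assume "z \<in> ?P"
    then have F: "commutator_map G n z \<in> carrier G" by (intro commutator_map_closed[OF G]) auto
    then have "inv (commutator_map G n z) \<otimes> h = \<one> \<longleftrightarrow> commutator_map G n z = h"
      using inv_solve_left[OF one_closed F h] r_one[OF F] by metis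
    moreover have "inv (commutator_map G n z) \<otimes> h \<in> carrier G" using F h by simp
    ultimately show "(if commutator_map G n z = h then of_nat (order G) else 0) =
        (\<Sum>\<psi>\<in>?I. \<psi> \<one> * \<psi> (inv (commutator_map G n z) \<otimes> h))"
      using regular_character_decomposition(2)[OF G fin] by simp
  qed
  also have "\<dots> = (\<Sum>\<psi>\<in>?I. \<psi> \<one> * ((of_nat (order G) / \<psi> \<one>) ^ (2 * n) * \<psi> h))"
    by (subst sum.swap) (simp add: sum_distrib_left[symmetric] irreducible_character_commutator_map_sum[OF G _ h])
  also have "\<dots> = (\<Sum>\<psi>\<in>?I. of_nat (order G) ^ (2 * n) * (\<psi> h / \<psi> \<one> ^ (2 * n - 1)))"
  proof (intro sum.cong refl)
    fix \<psi> assume "\<psi> \<in> ?I"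
    then obtain d where "d > 0" "\<psi> \<one> = of_nat d" using Irr_degree[OF G] by blast
    moreover have "\<psi> \<one> ^ (2 * n) = \<psi> \<one> * \<psi> \<one> ^ (2 * n - 1)"
      using n power_Suc[of "\<psi> \<one>" "2 * n - 1"] by simp
    ultimately show "\<psi> \<one> * ((of_nat (order G) / \<psi> \<one>) ^ (2 * n) * \<psi> h) =
        of_nat (order G) ^ (2 * n) * (\<psi> h / \<psi> \<one> ^ (2 * n - 1))"
      by (simp add: power_divide)
  qed
  also have "\<dots> = of_nat (order G) * (of_nat (order G) ^ (2 * n - 1) * (\<Sum>\<psi>\<in>?I. \<psi> h / \<psi> \<one> ^ (2 * n - 1)))"
    using n power_Suc[of "of_nat (order G) :: complex" "2 * n - 1"]
    by (simp only: sum_distrib_left[symmetric] mult.assoc[symmetric]) simp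
  finally show ?thesis using ordpos by simp
qed

section \<open>Representations that factor through an open normal subgroup\<close>

text \<open>
  After triangularisation the trace is the sum of \<open>d\<close> eigenvalues, each of them a root of unity.
\<close>

lemma norm_mat_trace_finite_order:
  fixes A :: "complex mat"
  assumes A: "A \<in> carrier_mat d d" and m: "m > 0" and pow: "A ^\<^sub>m m = 1\<^sub>m d"
  shows "norm (mat_trace A) \<le> real d"
proof -
  obtain as where as: "char_poly A = (\<Prod>a\<leftarrow>as. [:- a, 1:])" using char_poly_factorized[OF A] by blast
  obtain B where B: "B \<in> carrier_mat d d" "upper_triangular B" "similar_mat A B"
    using schur_decomposition_exists[OF A as] by blast
  obtain P Q where "similar_mat_wit B A P Q"
    using similar_mat_sym[OF B(3)] unfolding similar_mat_def by blast
  from similar_mat_witD2[OF B(1) this]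
  have PQ: "P \<in> carrier_mat d d" "Q \<in> carrier_mat d d" "Q * P = 1\<^sub>m d" "B = P * A * Q" by auto
  have trace: "mat_trace B = mat_trace A"
    unfolding PQ(4) by (rule mat_trace_similar[OF A PQ(2,1,3)])
  have "norm (B $$ (i, i)) = 1" if i: "i < d" for i
  proof -
    have "B $$ (i, i) \<in> set (diag_mat B)" using i B(1) by (auto simp: diag_mat_def)
    then have "poly (char_poly B) (B $$ (i, i)) = 0"
      unfolding char_poly_upper_triangular[OF B(1,2)] poly_prod_list by (auto simp: prod_list_zero_iff)
    then have "eigenvalue A (B $$ (i, i))"
      using eigenvalue_root_char_poly[OF A] char_poly_similar[OF B(3)] by simp
    then obtain v where v: "eigenvector A v (B $$ (i, i))" by (auto simp: eigenvalue_def)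
    then have vc: "v \<in> carrier_vec d" "v \<noteq> 0\<^sub>v d" using A by (auto simp: eigenvector_def)
    have eq: "v = (B $$ (i, i)) ^ m \<cdot>\<^sub>v v"
      using eigenvector_pow[OF A v, of m] pow vc by simp
    obtain j where j: "j < d" "v $ j \<noteq> 0" 
    proof -
      have "\<exists>j<d. v $ j \<noteq> 0"
      proof (rule ccontr)
        assume "\<not> ?thesis"
        then have "v = 0\<^sub>v d" using vc(1) by (intro eq_vecI) auto
        then show False using vc(2) by simp
      qed
      then show ?thesis using that by blast
    qed
    have "v $ j = (B $$ (i, i)) ^ m * v $ j"
      using arg_cong[OF eq, of "\<lambda>u. u $ j"] j vc by simp
    then have "(B $$ (i, i)) ^ m = 1" using j by simp
    then have "norm (B $$ (i, i)) ^ m = 1 ^ m" by (simp flip: norm_power)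
    then show ?thesis using m by (intro power_eq_imp_eq_base[of _ m 1]) auto
  qed
  then have "norm (mat_trace B) \<le> (\<Sum>i<d. 1)"
    unfolding mat_trace_def using B(1) by (intro order_trans[OF norm_sum] sum_mono) auto
  then show ?thesis using trace by simp
qed

lemma (in group) norm_character_le_degree:
  assumes \<rho>: "continuous_representation G T d \<rho>" and fin: "finite (carrier G)"
    and g: "g \<in> carrier G"
  shows "norm (mat_trace (\<rho> g)) \<le> real d"
proof -
  note r = continuous_representationD[OF is_group \<rho>]
  have pow: "\<rho> (g [^] (k::nat)) = \<rho> g ^\<^sub>m k" for k
    using g r by (induction k) (auto dest: r(1))
  have "\<rho> g ^\<^sub>m (order G) = 1\<^sub>m d"
    using pow[of "order G"] pow_order_eq_1[OF g] r(2) by simp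
  moreover have "order G > 0" using fin by (simp add: order_gt_0_iff_finite)
  ultimately show ?thesis using norm_mat_trace_finite_order[OF r(1)[OF g]] by blast
qed

context topological_group
begin

lemma open_right_translate:
  assumes "openin T U" "g \<in> carrier G"
  shows "openin T (U #> g)"
proof -
  have U: "U \<subseteq> carrier G" using openin_subset[OF assms(1)] by simp
  have "continuous_map T T (\<lambda>x. x \<otimes> inv g)"
  proof -
    have "continuous_map T (prod_topology T T) (\<lambda>x. (x, inv g))"
      using assms(2) by (simp add: continuous_map_paired)
    from continuous_map_compose[OF this continuous_mult] show ?thesis by (simp add: o_def)
  qed
  from openin_continuous_map_preimage[OF this assms(1)]
  have "openin T {x \<in> carrier G. x \<otimes> inv g \<in> U}" by simp
  also have "{x \<in> carrier G. x \<otimes> inv g \<in> U} = U #> g"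
  proof (intro equalityI subsetI)
    fix x assume "x \<in> {x \<in> carrier G. x \<otimes> inv g \<in> U}"
    then show "x \<in> U #> g"
      using assms(2) by (auto simp: r_coset_def m_assoc intro!: bexI[of _ "x \<otimes> inv g"])
  qed (use U assms(2) in \<open>auto simp: r_coset_def m_assoc subset_iff\<close>)
  finally show ?thesis .
qed

lemma closed_open_subgroup:
  assumes "openin T H" "subgroup H G"
  shows "closedin T H"
proof -
  have "carrier G - H = \<Union>{H #> g | g. g \<in> carrier G - H}"
  proof (intro equalityI subsetI)
    fix x assume "x \<in> carrier G - H"
    then show "x \<in> \<Union>{H #> g | g. g \<in> carrier G - H}" using rcos_self[OF _ assms(2)] by blast
  next
    fix x assume "x \<in> \<Union>{H #> g | g. g \<in> carrier G - H}"
    then obtain g where g: "g \<in> carrier G" "g \<notin> H" "x \<in> H #> g" by blast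
    then have eq: "H #> g = H #> x" using repr_independence assms(2) by blast
    have x: "x \<in> carrier G" using g subgroup.subset[OF assms(2)] r_coset_subset_G by blast
    have "x \<notin> H"
    proof
      assume "x \<in> H"
      then have "H #> g = H" using eq coset_join2[OF x assms(2)] by simp
      then show False using g coset_join1[OF _ g(1) assms(2)] by blast
    qed
    then show "x \<in> carrier G - H" using x by blast
  qed
  moreover have "openin T (\<Union>{H #> g | g. g \<in> carrier G - H})"
    using open_right_translate[OF assms(1)] by (intro openin_Union) auto
  ultimately show ?thesis using openin_subset[OF assms(1)] by (simp only: closedin_def topspace_eq)
qed

text \<open>
  The cosets form an open cover by disjoint nonempty sets, so a finite subcover contains all of them.
\<close>

lemma finite_quotient_by_open_subgroup:
  assumes "compact_space T" "openin T H" "subgroup H G"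
  shows "finite (rcosets H)"
proof -
  have op: "\<forall>c\<in>rcosets H. openin T c" using open_right_translate[OF assms(2)] by (auto simp: RCOSETS_def)
  obtain F where F: "finite F" "F \<subseteq> rcosets H" "\<Union>F = carrier G"
    using assms(1)[unfolded compact_space topspace_eq, THEN spec, THEN mp,
        OF conjI[OF op rcosets_part_G[OF assms(3)]]] by blast
  have "rcosets H \<subseteq> F"
  proof
    fix c assume c: "c \<in> rcosets H"
    then obtain x where x: "x \<in> carrier G" "c = H #> x" by (auto simp: RCOSETS_def)
    obtain c' where c': "c' \<in> F" "x \<in> c'" using F(3) x by blast
    then obtain y where "y \<in> carrier G" "c' = H #> y" using F(2) by (auto simp: RCOSETS_def)
    then have "c' = c" using repr_independence[of x H y] c'(2) x(2) assms(3) by simp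
    then show "c \<in> F" using c'(1) by simp
  qed
  then show ?thesis using F finite_subset by blast
qed

end

text \<open>
  The condition is put on the representation, since that is the form in which it descends to \<open>G/H\<close>.
\<close>

definition characters_trivial_on :: "('a, 'b) monoid_scheme \<Rightarrow> 'a topology \<Rightarrow> 'a set \<Rightarrow> ('a \<Rightarrow> complex) set" where
  "characters_trivial_on G T H = {\<lambda>g \<in> carrier G. mat_trace (\<rho> g) |d \<rho>.
     continuous_representation G T d \<rho> \<and> irreducible_representation G d \<rho> \<and> (\<forall>h\<in>H. \<rho> h = 1\<^sub>m d)}"

lemma (in group) irreducible_representation_cong_invariant_sets:
  assumes "\<And>W. (\<forall>g\<in>carrier G. \<forall>w\<in>W. \<rho> g *\<^sub>v w \<in> W) \<longleftrightarrow> (\<forall>g\<in>carrier Q. \<forall>w\<in>W. \<sigma> g *\<^sub>v w \<in> W)"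
  shows "irreducible_representation G d \<rho> \<longleftrightarrow> irreducible_representation Q d \<sigma>"
  unfolding irreducible_representation_def using assms by simp

text \<open>
  Inflation from \<open>G/H\<close>. A representation of the discrete group \<open>G/H\<close> is continuous on \<open>G\<close> since its
  preimages are unions of open cosets; conversely a representation trivial on \<open>H\<close> is constant on
  cosets. Irreducibility is preserved because the sets of matrices that occur are the same.
\<close>

lemma (in topological_group) characters_trivial_on_eq_pullback:
  assumes H: "openin T H" "H \<lhd> G"
  shows "characters_trivial_on G T H =
    (\<lambda>\<psi>. \<lambda>g\<in>carrier G. \<psi> (H #> g)) ` Irr (G Mod H) (discrete_topology (carrier (G Mod H)))"
    (is "_ = ?pull ` Irr ?Q ?D")
proof (intro equalityI subsetI)
  interpret normal H G by (rule H(2))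
  have Q: "group ?Q" by (rule factorgroup_is_group)
  fix \<psi> assume "\<psi> \<in> characters_trivial_on G T H"
  then obtain d \<rho> where \<rho>: "continuous_representation G T d \<rho>" "irreducible_representation G d \<rho>"
    and triv: "\<forall>h\<in>H. \<rho> h = 1\<^sub>m d" and \<psi>: "\<psi> = (\<lambda>g\<in>carrier G. mat_trace (\<rho> g))"
    unfolding characters_trivial_on_def by blast
  note r = continuous_representationD[OF is_group \<rho>(1)]
  have "\<rho> x = \<rho> y" if xy: "x \<in> carrier G" "y \<in> carrier G" "H #> x = H #> y" for x y
  proof -
    have "x \<in> H #> y" using rcos_self[OF xy(1) subgroup_axioms] xy(3) by simp
    then obtain h where "h \<in> H" "x = h \<otimes> y" by (auto simp: r_coset_def)
    then show ?thesis using triv r(3)[of h y] r(1)[OF xy(2)] xy(2) subset by auto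
  qed
  with FactGroup_universal[of \<rho> G "GL d" H] \<rho>(1) H(2)
  obtain \<sigma> where \<sigma>: "\<sigma> \<in> hom ?Q (GL d)" "\<And>x. x \<in> carrier G \<Longrightarrow> \<sigma> (H #> x) = \<rho> x"
    unfolding continuous_representation_def by metis
  have "continuous_representation ?Q ?D d \<sigma>"
    unfolding continuous_representation_def using \<sigma>(1) by auto
  moreover have "irreducible_representation ?Q d \<sigma>"
    using \<rho>(2) by (subst irreducible_representation_cong_invariant_sets[symmetric, of \<rho>])
      (auto simp: carrier_FactGroup \<sigma>(2))
  ultimately have "(\<lambda>c\<in>carrier ?Q. mat_trace (\<sigma> c)) \<in> Irr ?Q ?D" unfolding Irr_def by blast
  moreover have "\<psi> = ?pull (\<lambda>c\<in>carrier ?Q. mat_trace (\<sigma> c))"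
    unfolding \<psi> using \<sigma>(2) by (intro restrict_ext) (auto simp: carrier_FactGroup)
  ultimately show "\<psi> \<in> ?pull ` Irr ?Q ?D" by blast
next
  interpret normal H G by (rule H(2))
  have Q: "group ?Q" by (rule factorgroup_is_group)
  fix \<psi> assume "\<psi> \<in> ?pull ` Irr ?Q ?D"
  then obtain d \<sigma> where \<sigma>: "continuous_representation ?Q ?D d \<sigma>" "irreducible_representation ?Q d \<sigma>"
    and \<psi>: "\<psi> = ?pull (\<lambda>c\<in>carrier ?Q. mat_trace (\<sigma> c))"
    unfolding Irr_def by blast
  note s = continuous_representationD[OF Q \<sigma>(1)]
  define \<rho> where "\<rho> = (\<lambda>g. \<sigma> (H #> g))"
  have HQ: "H #> g \<in> carrier ?Q" if "g \<in> carrier G" for g using that by (auto simp: carrier_FactGroup)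
  have "continuous_representation G T d \<rho>"
  proof (rule continuous_representationI[OF is_group])
    show "\<rho> \<one> = 1\<^sub>m d" using s(2) coset_mult_one[OF subset] by (simp add: \<rho>_def)
    show "\<rho> (g \<otimes> h) = \<rho> g * \<rho> h" if "g \<in> carrier G" "h \<in> carrier G" for g h
      using s(3)[OF HQ[OF that(1)] HQ[OF that(2)]] rcos_sum[OF that] by (simp add: \<rho>_def)
    fix i j assume "i < d" "j < d"
    show "continuous_map T euclidean (\<lambda>g. \<rho> g $$ (i, j))"
      unfolding continuous_map_def
    proof (intro conjI allI impI)
      fix U :: "complex set"
      have "{g \<in> topspace T. \<rho> g $$ (i, j) \<in> U} = \<Union>{H #> g | g. g \<in> carrier G \<and> \<rho> g $$ (i, j) \<in> U}"
      proof (intro equalityI subsetI)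
        fix x assume "x \<in> {g \<in> topspace T. \<rho> g $$ (i, j) \<in> U}"
        then show "x \<in> \<Union>{H #> g | g. g \<in> carrier G \<and> \<rho> g $$ (i, j) \<in> U}"
          using rcos_self[OF _ subgroup_axioms] by auto
      next
        fix x assume "x \<in> \<Union>{H #> g | g. g \<in> carrier G \<and> \<rho> g $$ (i, j) \<in> U}"
        then obtain g where g: "g \<in> carrier G" "\<rho> g $$ (i, j) \<in> U" "x \<in> H #> g" by blast
        then have "H #> g = H #> x" using repr_independence subgroup_axioms by blast
        moreover have "x \<in> carrier G" using g subset r_coset_subset_G by blast
        ultimately show "x \<in> {g \<in> topspace T. \<rho> g $$ (i, j) \<in> U}" using g by (simp add: \<rho>_def)
      qed
      moreover have "openin T (\<Union>{H #> g | g. g \<in> carrier G \<and> \<rho> g $$ (i, j) \<in> U})"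
        using open_right_translate[OF H(1)] by (intro openin_Union) auto
      ultimately show "openin T {g \<in> topspace T. \<rho> g $$ (i, j) \<in> U}" by simp
    qed auto
  qed (use s(1) HQ in \<open>simp add: \<rho>_def\<close>)
  moreover have "irreducible_representation G d \<rho>"
    using \<sigma>(2) by (subst irreducible_representation_cong_invariant_sets[of _ ?Q \<sigma>])
      (auto simp: carrier_FactGroup \<rho>_def)
  moreover have "\<forall>h\<in>H. \<rho> h = 1\<^sub>m d"
    using s(2) coset_join2[OF _ subgroup_axioms] subset by (auto simp: \<rho>_def)
  moreover have "\<psi> = (\<lambda>g\<in>carrier G. mat_trace (\<rho> g))"
    unfolding \<psi> using HQ by (intro restrict_ext) (simp add: \<rho>_def)
  ultimately show "\<psi> \<in> characters_trivial_on G T H" unfolding characters_trivial_on_def by blast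
qed

text \<open>
  With \<open>A = 1 + B\<close> one has \<open>A\<^sup>2 - 1 = 2 B + B\<^sup>2\<close>, and for small \<open>B\<close> the quadratic term is at most a
  quarter of the linear one at the largest entry. So squaring pushes a matrix away from the
  identity by a fixed factor, and no nontrivial group of matrices stays near the identity.
\<close>

lemma matrix_near_one_expands:
  fixes A :: "complex mat"
  assumes A: "A \<in> carrier_mat d d" and ij: "i < d" "j < d"
    and max: "\<And>k l. k < d \<Longrightarrow> l < d \<Longrightarrow> norm ((A - 1\<^sub>m d) $$ (k, l)) \<le> norm ((A - 1\<^sub>m d) $$ (i, j))"
    and small: "real d * norm ((A - 1\<^sub>m d) $$ (i, j)) \<le> 1 / 2"
  shows "3 / 2 * norm ((A - 1\<^sub>m d) $$ (i, j)) \<le> norm ((A * A - 1\<^sub>m d) $$ (i, j))"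
proof -
  define B where "B = A - 1\<^sub>m d"
  have B: "B \<in> carrier_mat d d" by (simp add: B_def minus_carrier_mat)
  define m where "m = norm (B $$ (i, j))"
  have Aeq: "A = B + 1\<^sub>m d" using A by (auto simp: B_def)
  have "A * A = B * B + B + B + 1\<^sub>m d"
    using B unfolding Aeq
    by (simp add: add_mult_distrib_mat[of _ d d] mult_add_distrib_mat[of _ d d] assoc_add_mat[of _ d d])
  then have "(A * A - 1\<^sub>m d) $$ (i, j) = (B * B) $$ (i, j) + 2 * B $$ (i, j)"
    using B ij by simp
  moreover have "norm ((B * B) $$ (i, j)) \<le> 1 / 2 * m"
  proof -
    have "norm ((B * B) $$ (i, j)) \<le> (\<Sum>l<d. m * m)"
      unfolding mat_mult_entry[OF B B ij]
    proof (intro order_trans[OF norm_sum] sum_mono)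
      fix l assume "l \<in> {..<d}"
      then have "norm (B $$ (i, l)) \<le> m" "norm (B $$ (l, j)) \<le> m"
        using max ij unfolding B_def m_def by blast+
      then show "norm (B $$ (i, l) * B $$ (l, j)) \<le> m * m"
        unfolding norm_mult by (intro mult_mono) (auto simp: m_def)
    qed
    also have "\<dots> = (real d * m) * m" by simp
    also have "\<dots> \<le> 1 / 2 * m" using small by (intro mult_right_mono) (auto simp: m_def B_def)
    finally show ?thesis .
  qed
  moreover have "norm (2 * B $$ (i, j)) \<le> norm ((B * B) $$ (i, j) + 2 * B $$ (i, j)) + norm ((B * B) $$ (i, j))"
    using norm_triangle_ineq4[of "(B * B) $$ (i, j) + 2 * B $$ (i, j)" "(B * B) $$ (i, j)"] by simp
  moreover have "norm (2 * B $$ (i, j)) = 2 * m" by (simp add: m_def norm_mult)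
  ultimately show ?thesis unfolding m_def B_def[symmetric] by simp
qed

section \<open>Irreducible characters along a chain of open normal subgroups\<close>

locale profinite_chain = profinite_group +
  fixes N :: "nat \<Rightarrow> 'a set"
  assumes open_N: "openin T (N i)" and normal_N: "N i \<lhd> G"
    and decseq_N: "decseq N" and Inter_N: "(\<Inter>i. N i) = {\<one>}"
begin

lemma subgroup_N: "subgroup (N i) G"
  using normal_N by (rule normal.axioms(1))

lemma finite_quotient: "finite (carrier (G Mod N i))"
  using finite_quotient_by_open_subgroup[OF compact open_N subgroup_N] by (simp add: FactGroup_def)

text \<open>
  The sets \<open>N i - U\<close> are closed and decreasing with empty intersection, so by compactness one of
  them is empty.
\<close>

lemma chain_neighbourhood_basis_one:
  assumes "openin T U" "\<one> \<in> U"
  obtains i where "N i \<subseteq> U"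
proof (rule ccontr)
  assume "\<not> thesis"
  then have ne: "N i - U \<noteq> {}" for i using that by blast
  have closed: "closedin T (N i - U)" for i
    using closed_open_subgroup[OF open_N subgroup_N] assms(1) by (rule closedin_diff)
  have dec: "decseq (\<lambda>i. N i - U)" using decseq_N unfolding decseq_def by blast
  have "(\<Inter>i. N i - U) \<noteq> {}" by (rule compact_space_imp_nest[OF compact closed ne dec])
  then obtain x where x: "\<And>i. x \<in> N i - U" by auto
  then have "x \<in> (\<Inter>i. N i)" by simp
  then have "x = \<one>" using Inter_N by simp
  then show False using x assms(2) by simp
qed

lemma chain_neighbourhood_basis:
  assumes U: "openin T U" "g \<in> U"
  obtains i where "N i #> g \<subseteq> U"
proof -
  have Uc: "U \<subseteq> carrier G" using openin_subset[OF U(1)] by simp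
  then have g: "g \<in> carrier G" using U by blast
  have "openin T (U #> inv g)" using U g by (intro open_right_translate) auto
  moreover have "\<one> \<in> U #> inv g" using U g r_inv[OF g] unfolding r_coset_def by force
  ultimately obtain i where i: "N i \<subseteq> U #> inv g" using chain_neighbourhood_basis_one by blast
  have "x \<otimes> g \<in> U" if x: "x \<in> N i" for x
  proof -
    obtain u where "u \<in> U" "x = u \<otimes> inv g" using i x unfolding r_coset_def by blast
    then show ?thesis using Uc g by (auto simp: m_assoc)
  qed
  then show ?thesis using that[of i] unfolding r_coset_def by blast
qed

text \<open>
  There are no small subgroups: on an \<open>N k\<close> whose matrices all lie within \<open>e\<close> of the identity, let
  \<open>s\<close> be the supremum of the absolute values of the entries of \<open>\<rho> h - 1\<close>. As \<open>N k\<close> is closed under squaring, the expansion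
  of \<open>A \<mapsto> A\<^sup>2\<close> near \<open>1\<close> gives \<open>3/2 s \<le> s\<close>.
\<close>

lemma representation_trivial_on_chain:
  assumes \<rho>: "continuous_representation G T d \<rho>"
  obtains i where "\<forall>h\<in>N i. \<rho> h = 1\<^sub>m d"
proof -
  note r = continuous_representationD[OF is_group \<rho>]
  \<comment> \<open>The summand \<open>1\<close> keeps \<open>e\<close> finite for \<open>d = 0\<close>; only \<open>real d * e \<le> 1 / 2\<close> matters.\<close>
  define e where "e = 1 / (2 * (real d + 1))"
  have e_pos: "e > 0" by (simp add: e_def add_pos_nonneg)
  have "(real d + 1) * e = 1 / 2" by (simp add: e_def)
  then have "real d * e \<le> 1 / 2" using e_pos by (simp add: distrib_right)
  note e = e_pos this
  define V where "V = (\<lambda>(i, j). {g \<in> carrier G. \<rho> g $$ (i, j) \<in> ball (1\<^sub>m d $$ (i, j)) e})"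
  define U where "U = carrier G \<inter> \<Inter>(V ` ({..<d} \<times> {..<d}))"
  have openV: "openin T (V p)" if p: "p \<in> {..<d} \<times> {..<d}" for p
  proof -
    obtain i j where ij: "p = (i, j)" "i < d" "j < d" using p by auto
    from openin_continuous_map_preimage[OF r(4)[OF ij(2,3)], of "ball (1\<^sub>m d $$ (i, j)) e"]
    show ?thesis by (simp add: V_def ij(1))
  qed
  have "openin T U"
  proof (cases "d = 0")
    case True
    then show ?thesis using openin_topspace[of T] by (simp add: U_def)
  next
    case False
    have "openin T (\<Inter>(V ` ({..<d} \<times> {..<d})))"
      using openV False by (intro openin_Inter) (auto simp: lessThan_empty_iff)
    then show ?thesis using openin_topspace[of T] by (auto simp: U_def)
  qed
  moreover have "\<one> \<in> U" using r(2) e by (auto simp: U_def V_def)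
  ultimately obtain k where k: "N k \<subseteq> U" using chain_neighbourhood_basis_one by blast
  have small: "norm ((\<rho> h - 1\<^sub>m d) $$ (i, j)) < e" if "h \<in> N k" "i < d" "j < d" for h i j
  proof -
    have "h \<in> V (i, j)" using k that unfolding U_def by blast
    moreover have "\<rho> h \<in> carrier_mat d d" using r(1) k that unfolding U_def by blast
    ultimately show ?thesis using that by (auto simp: V_def dist_norm norm_minus_commute)
  qed
  define D where "D = {norm ((\<rho> h - 1\<^sub>m d) $$ (i, j)) | h i j. h \<in> N k \<and> i < d \<and> j < d}"
  define s where "s = Sup D"
  have bdd: "bdd_above D" using small unfolding D_def bdd_above_def by (force intro: less_imp_le)
  have le_s: "norm ((\<rho> h - 1\<^sub>m d) $$ (i, j)) \<le> s" if "h \<in> N k" "i < d" "j < d" for h i j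
    unfolding s_def using that by (intro cSup_upper bdd) (unfold D_def, blast)
  have step: "3 / 2 * norm ((\<rho> h - 1\<^sub>m d) $$ (i, j)) \<le> s" if h: "h \<in> N k" and ij: "i < d" "j < d" for h i j
  proof -
    have hc: "h \<in> carrier G" using h k unfolding U_def by blast
    define f where "f = (\<lambda>p. norm ((\<rho> h - 1\<^sub>m d) $$ p))"
    have fin: "finite ({..<d} \<times> {..<d})" "{..<d} \<times> {..<d} \<noteq> {}" using ij by auto
    \<comment> \<open>The expansion estimate applies only at a largest entry \<open>p\<close> of \<open>\<rho> h - 1\<close>.\<close>
    obtain p where p: "p \<in> {..<d} \<times> {..<d}" "f p = Max (f ` ({..<d} \<times> {..<d}))"
      using Max_in[of "f ` ({..<d} \<times> {..<d})"] fin by fastforce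
    have maxp: "f q \<le> f p" if "q \<in> {..<d} \<times> {..<d}" for q
      unfolding p(2) using that fin by (intro Max_ge) auto
    obtain a b where ab: "p = (a, b)" "a < d" "b < d" using p(1) by auto
    have "real d * f p \<le> real d * e"
      using small[OF h ab(2,3)] by (intro mult_left_mono) (auto simp: f_def ab(1))
    then have "3 / 2 * f p \<le> norm ((\<rho> h * \<rho> h - 1\<^sub>m d) $$ (a, b))"
      using matrix_near_one_expands[OF r(1)[OF hc] ab(2,3)] maxp e(2) unfolding f_def ab(1) by force
    also have "\<dots> = norm ((\<rho> (h \<otimes> h) - 1\<^sub>m d) $$ (a, b))" using r(3)[OF hc hc] by simp
    also have "\<dots> \<le> s" using h subgroup.m_closed[OF subgroup_N] ab by (intro le_s) auto
    finally show ?thesis using maxp[of "(i, j)"] ij unfolding f_def by simp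
  qed
  have "\<rho> h = 1\<^sub>m d" if h: "h \<in> N k" for h
  proof (rule eq_matI)
    have hc: "h \<in> carrier G" using h k unfolding U_def by blast
    show "dim_row (\<rho> h) = dim_row (1\<^sub>m d :: complex mat)" "dim_col (\<rho> h) = dim_col (1\<^sub>m d :: complex mat)"
      using r(1)[OF hc] by auto
    fix i j assume "i < dim_row (1\<^sub>m d :: complex mat)" "j < dim_col (1\<^sub>m d :: complex mat)"
    then have ij: "i < d" "j < d" by auto
    have ne: "D \<noteq> {}" using h ij unfolding D_def by blast
    have "s \<le> 2 / 3 * s"
      unfolding s_def
    proof (rule cSup_least[OF ne])
      fix x assume "x \<in> D"
      then obtain h i j where "h \<in> N k" "i < d" "j < d" "x = norm ((\<rho> h - 1\<^sub>m d) $$ (i, j))"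
        unfolding D_def by blast
      with step[of h i j] show "x \<le> 2 / 3 * Sup D" by (simp add: s_def)
    qed
    then have "s \<le> 0" by simp
    then have "norm ((\<rho> h - 1\<^sub>m d) $$ (i, j)) \<le> 0" by (rule order_trans[OF le_s[OF h ij]])
    then show "\<rho> h $$ (i, j) = 1\<^sub>m d $$ (i, j)" using r(1)[OF hc] ij by simp
  qed
  then show ?thesis using that by blast
qed

definition Irr_level :: "nat \<Rightarrow> ('a \<Rightarrow> complex) set" where
  "Irr_level i = characters_trivial_on G T (N i)"

lemma Irr_eq_Union_levels: "Irr G T = (\<Union>i. Irr_level i)"
proof (intro equalityI subsetI)
  fix \<psi> assume "\<psi> \<in> Irr G T"
  then obtain d \<rho> where \<rho>: "continuous_representation G T d \<rho>" "irreducible_representation G d \<rho>"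
    "\<psi> = (\<lambda>g\<in>carrier G. mat_trace (\<rho> g))" unfolding Irr_def by blast
  obtain i where "\<forall>h\<in>N i. \<rho> h = 1\<^sub>m d" using representation_trivial_on_chain[OF \<rho>(1)] .
  then show "\<psi> \<in> (\<Union>i. Irr_level i)" using \<rho> unfolding Irr_level_def characters_trivial_on_def by blast
qed (auto simp: Irr_level_def characters_trivial_on_def Irr_def)

lemma Irr_level_mono:
  assumes "i \<le> j" shows "Irr_level i \<subseteq> Irr_level j"
  using decseqD[OF decseq_N assms] unfolding Irr_level_def characters_trivial_on_def by blast

lemma Irr_level_eq_pullback:
  "Irr_level i = (\<lambda>\<psi>. \<lambda>g\<in>carrier G. \<psi> (N i #> g)) ` Irr (G Mod N i) (discrete_topology (carrier (G Mod N i)))"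
  unfolding Irr_level_def by (rule characters_trivial_on_eq_pullback[OF open_N normal_N])

lemma finite_Irr_level: "finite (Irr_level i)"
  unfolding Irr_level_eq_pullback
  using finite_Irr_finite_group[OF normal.factorgroup_is_group[OF normal_N] finite_quotient] by blast

lemma finite_subset_Irr_level:
  assumes "finite F" "F \<subseteq> Irr G T"
  obtains i where "F \<subseteq> Irr_level i"
proof -
  have "\<exists>i. F \<subseteq> Irr_level i"
    using assms
  proof (induction F)
    case (insert \<psi> F)
    then obtain i j where "F \<subseteq> Irr_level i" "\<psi> \<in> Irr_level j" using Irr_eq_Union_levels by auto
    then have "insert \<psi> F \<subseteq> Irr_level (max i j)"
      using Irr_level_mono[of i "max i j"] Irr_level_mono[of j "max i j"] by auto
    then show ?case by blast
  qed simp
  then show ?thesis using that by blast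
qed

text \<open>
  The levels are cofinal among the finite subsets of \<open>Irr G T\<close>, so an unordered sum over \<open>Irr G T\<close> is
  the limit of the sums over the levels.
\<close>

lemma Irr_level_filterlim:
  "filterlim Irr_level (finite_subsets_at_top (Irr G T)) sequentially"
  unfolding filterlim_iff
proof (intro allI impI)
  fix P assume "eventually P (finite_subsets_at_top (Irr G T))"
  from this[unfolded eventually_finite_subsets_at_top]
  obtain F where F: "finite F \<and> F \<subseteq> Irr G T \<and> (\<forall>Y. finite Y \<and> F \<subseteq> Y \<and> Y \<subseteq> Irr G T \<longrightarrow> P Y)"
    by (rule exE)
  obtain i where i: "F \<subseteq> Irr_level i" using finite_subset_Irr_level[OF F[THEN conjunct1] F[THEN conjunct2, THEN conjunct1]] .
  have "P (Irr_level j)" if "i \<le> j" for j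
  proof -
    have "F \<subseteq> Irr_level j" by (rule order_trans[OF i Irr_level_mono[OF that]])
    moreover have "Irr_level j \<subseteq> Irr G T" unfolding Irr_eq_Union_levels by (rule UN_upper) simp
    ultimately show ?thesis using F[THEN conjunct2, THEN conjunct2] finite_Irr_level[of j] by simp
  qed
  then show "eventually (\<lambda>j. P (Irr_level j)) sequentially"
    unfolding eventually_sequentially by blast
qed

text \<open>
  In a finite quotient every element has finite order, and there the trace bound applies.
\<close>

lemma norm_character_le:
  assumes "\<psi> \<in> Irr G T" "g \<in> carrier G"
  shows "norm (\<psi> g) \<le> norm (\<psi> \<one>)"
proof -
  obtain i where "\<psi> \<in> Irr_level i" using assms Irr_eq_Union_levels by blast
  then obtain \<phi> where \<phi>: "\<phi> \<in> Irr (G Mod N i) (discrete_topology (carrier (G Mod N i)))"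
    "\<psi> = (\<lambda>g\<in>carrier G. \<phi> (N i #> g))" unfolding Irr_level_eq_pullback by blast
  interpret Q: group "G Mod N i" by (rule normal.factorgroup_is_group[OF normal_N])
  obtain d \<sigma> where \<sigma>: "continuous_representation (G Mod N i) (discrete_topology (carrier (G Mod N i))) d \<sigma>"
    and \<phi>_eq: "\<phi> = (\<lambda>c\<in>carrier (G Mod N i). mat_trace (\<sigma> c))"
    using IrrE[OF \<phi>(1)] .
  have c: "N i #> g \<in> carrier (G Mod N i)" using assms by (auto simp: carrier_FactGroup)
  have "N i #> \<one> = N i" by (rule coset_mult_one[OF subgroup.subset[OF subgroup_N]])
  then have "\<psi> \<one> = of_nat d" using character_one[OF Q.is_group \<sigma> \<phi>_eq] \<phi>(2) by simp
  moreover have "norm (\<psi> g) \<le> real d"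
    using Q.norm_character_le_degree[OF \<sigma> finite_quotient c] c assms by (simp add: \<phi>(2) \<phi>_eq)
  ultimately show ?thesis by simp
qed

end

lemma commutator_map_quotient:
  fixes G (structure)
  assumes H: "H \<lhd> G" and z: "\<And>i. i < 2 * k \<Longrightarrow> z i \<in> carrier G"
  shows "commutator_map (G Mod H) k (\<lambda>i. H #> z i) = H #> commutator_map G k z"
proof -
  interpret normal H G by (rule H)
  interpret h: group_hom G "G Mod H" "\<lambda>g. H #> g"
    using factorgroup_is_group r_coset_hom_Mod
    by (intro group_hom.intro group_hom_axioms.intro is_group)
  show ?thesis using z
  proof (induction k)
    case 0
    show ?case using h.hom_one by simp
  next
    case (Suc k)
    have "commutator_map G k z \<in> carrier G" using Suc.prems by (intro commutator_map_closed is_group) auto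
    then show ?case using Suc by (simp add: group_commutator_def del: mult_FactGroup)
  qed
qed

lemma (in prob_space) measure_equal_partition:
  assumes fin: "finite P" and sets: "P \<subseteq> sets M" and disj: "disjoint P" and cover: "\<Union>P = space M"
    and eq: "\<And>A B. A \<in> P \<Longrightarrow> B \<in> P \<Longrightarrow> prob A = prob B" and A: "A \<in> P"
  shows "prob A = 1 / real (card P)"
proof -
  have "1 = prob (\<Union>P)" using cover prob_space by simp
  also have "\<dots> = (\<Sum>B\<in>P. prob B)"
    using finite_measure_finite_Union[OF fin, of "\<lambda>B. B"] sets disj
    by (auto simp: disjoint_family_on_def disjoint_def pairwise_def disjnt_def)
  also have "\<dots> = real (card P) * prob A" using eq[OF _ A] by simp
  finally show ?thesis by (metis mult.commute nonzero_eq_divide_eq mult_zero_right zero_neq_one)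
qed

section \<open>Haar measure of cosets and of commutator preimages\<close>

lemma normalized_haar_measureD:
  assumes "normalized_haar_measure G T \<mu>"
  shows "prob_space \<mu>" and "sets \<mu> = sigma_sets (topspace T) {U. openin T U}"
    and "space \<mu> = topspace T" and "\<And>U. openin T U \<Longrightarrow> U \<in> sets \<mu>"
    and "\<And>g A. g \<in> carrier G \<Longrightarrow> A \<in> sets \<mu> \<Longrightarrow> measure \<mu> (g <#\<^bsub>G\<^esub> A) = measure \<mu> A"
proof -
  have *: "{U. openin T U} \<subseteq> Pow (topspace T)" using openin_subset by auto
  have **: "sets \<mu> = sets (borel_of T)" using assms unfolding normalized_haar_measure_def by blast
  show sets: "sets \<mu> = sigma_sets (topspace T) {U. openin T U}"
    unfolding ** borel_of_def using * by (rule sets_measure_of)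
  show "space \<mu> = topspace T"
    using sets_eq_imp_space_eq[OF **] space_measure_of[OF *] unfolding borel_of_def by simp
  show "U \<in> sets \<mu>" if "openin T U" for U unfolding sets using that by blast
  show "prob_space \<mu>" using assms unfolding normalized_haar_measure_def by blast
  show "measure \<mu> (g <#\<^bsub>G\<^esub> A) = measure \<mu> A" if "g \<in> carrier G" "A \<in> sets \<mu>" for g A
    using assms that unfolding normalized_haar_measure_def measure_def by simp
qed

lemma (in topological_group) haar_measure_coset:
  assumes "normalized_haar_measure G T \<mu>" and H: "openin T H" "H \<lhd> G" and fin: "finite (rcosets H)"
    and c: "c \<in> rcosets H"
  shows "measure \<mu> c = 1 / real (card (rcosets H))"
proof -
  note haar = normalized_haar_measureD[OF assms(1)]
  interpret prob_space \<mu> by (rule haar(1))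
  interpret normal H G by (rule H(2))
  have eqH: "prob A = prob H" if "A \<in> rcosets H" for A
  proof -
    obtain g where g: "g \<in> carrier G" "A = g <# H" using \<open>A \<in> rcosets H\<close> coset_eq by (auto simp: RCOSETS_def)
    then show ?thesis using haar(5)[OF g(1) haar(4)[OF H(1)]] by simp
  qed
  show ?thesis
  proof (rule measure_equal_partition[OF fin _ _ _ _ c])
    show "rcosets H \<subseteq> sets \<mu>" using open_right_translate[OF H(1)] haar(4) by (auto simp: RCOSETS_def)
    show "disjoint (rcosets H)"
      using rcos_disjoint[OF subgroup_axioms] by (simp add: disjoint_def pairwise_def disjnt_def)
    show "\<Union>(rcosets H) = space \<mu>" using rcosets_part_G[OF subgroup_axioms] haar(3) by simp
    show "prob A = prob B" if "A \<in> rcosets H" "B \<in> rcosets H" for A B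
      using eqH[OF that(1)] eqH[OF that(2)] by simp
  qed
qed

text \<open>
  The boxes \<open>c\<^sub>0 \<times> c\<^sub>1 \<times> \<dots>\<close> of cosets partition the power, and each of them is a left translate of
  \<open>H \<times> H \<times> \<dots>\<close>. So invariance and total mass one determine their measure.
\<close>

lemma (in topological_group) haar_measure_coset_box:
  assumes "normalized_haar_measure (power_group G m) (power_topology T m) \<nu>"
    and H: "openin T H" "H \<lhd> G" and fin: "finite (rcosets H)"
    and c: "c \<in> PiE {..<m} (\<lambda>_. rcosets H)"
  shows "measure \<nu> (PiE {..<m} c) = 1 / real (card (rcosets H)) ^ m"
proof -
  note haar = normalized_haar_measureD[OF assms(1)]
  interpret prob_space \<nu> by (rule haar(1))
  interpret normal H G by (rule H(2))
  let ?C = "PiE {..<m} (\<lambda>_. rcosets H)"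
  define P where "P = (\<lambda>c. PiE {..<m} c) ` ?C"
  have openbox: "openin (power_topology T m) (PiE {..<m} b)" if "\<And>k. k < m \<Longrightarrow> openin T (b k)" for b
    using that by (simp add: openin_PiE)
  have open_coset: "openin T A" if "A \<in> rcosets H" for A
    using that open_right_translate[OF H(1)] by (auto simp: RCOSETS_def)
  have common: "b = b'" if b: "b \<in> ?C" "b' \<in> ?C" and z: "z \<in> PiE {..<m} b" "z \<in> PiE {..<m} b'" for b b' z
  proof (rule PiE_ext[OF b])
    fix k assume k: "k \<in> {..<m}"
    have "z k \<in> b k \<inter> b' k" using PiE_mem[OF z(1) k] PiE_mem[OF z(2) k] by blast
    moreover have "b k \<in> rcosets H" "b' k \<in> rcosets H" using PiE_mem[OF b(1) k] PiE_mem[OF b(2) k] by auto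
    ultimately show "b k = b' k"
      using pairwiseD[OF rcos_disjoint[OF subgroup_axioms], of "b k" "b' k"] by (auto simp: disjnt_def)
  qed
  have nonempty: "\<exists>z. z \<in> PiE {..<m} b \<and> z \<in> carrier (power_group G m)" if b: "b \<in> ?C" for b
  proof -
    have "\<exists>x. x \<in> b k \<and> x \<in> carrier G" if k: "k \<in> {..<m}" for k
    proof -
      obtain g where "g \<in> carrier G" "b k = H #> g" using PiE_mem[OF b k] by (auto simp: RCOSETS_def)
      then show ?thesis using rcos_self[OF _ subgroup_axioms] by blast
    qed
    then obtain f where f: "\<And>k. k \<in> {..<m} \<Longrightarrow> f k \<in> b k \<and> f k \<in> carrier G" by metis
    then show ?thesis by (intro exI[of _ "restrict f {..<m}"]) auto
  qed
  have eqH: "prob (PiE {..<m} b) = prob (PiE {..<m} (\<lambda>_. H))" if b: "b \<in> ?C" for b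
  proof -
    obtain z where z: "z \<in> PiE {..<m} b" "z \<in> carrier (power_group G m)" using nonempty[OF b] by blast
    have zc: "z k \<in> carrier G" if "k \<in> {..<m}" for k using z(2) that by auto
    have bk: "b k = z k <# H" if k: "k \<in> {..<m}" for k
    proof -
      obtain g where g: "g \<in> carrier G" "b k = H #> g" using PiE_mem[OF b k] by (auto simp: RCOSETS_def)
      then have "b k = H #> z k" using repr_independence[OF _ g(1) subgroup_axioms] PiE_mem[OF z(1) k] by simp
      then show ?thesis using coset_eq zc[OF k] by simp
    qed
    have "PiE {..<m} b = z <#\<^bsub>power_group G m\<^esub> PiE {..<m} (\<lambda>_. H)"
    proof (intro equalityI subsetI)
      fix w assume w: "w \<in> PiE {..<m} b"
      define h where "h = (\<lambda>k\<in>{..<m}. inv (z k) \<otimes> w k)"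
      have hk: "h k \<in> H \<and> z k \<otimes> h k = w k" if k: "k \<in> {..<m}" for k
      proof -
        obtain x where "x \<in> H" "w k = z k \<otimes> x"
          using PiE_mem[OF w k] unfolding bk[OF k] l_coset_def by blast
        then show ?thesis using zc[OF k] subset k by (auto simp: h_def m_assoc[symmetric])
      qed
      then have "h \<in> PiE {..<m} (\<lambda>_. H)" by (intro PiE_I) (auto simp: h_def)
      moreover have "w = (\<lambda>k\<in>{..<m}. z k \<otimes> h k)"
        using PiE_arb[OF w] hk by (intro ext) (auto simp: restrict_def)
      ultimately show "w \<in> z <#\<^bsub>power_group G m\<^esub> PiE {..<m} (\<lambda>_. H)"
        unfolding l_coset_def by auto
    next
      fix w assume "w \<in> z <#\<^bsub>power_group G m\<^esub> PiE {..<m} (\<lambda>_. H)"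
      then obtain h where h: "h \<in> PiE {..<m} (\<lambda>_. H)" "w = (\<lambda>k\<in>{..<m}. z k \<otimes> h k)"
        unfolding l_coset_def by auto
      show "w \<in> PiE {..<m} b"
        unfolding h(2)
      proof (rule restrict_PiE_iff[THEN iffD2], rule ballI)
        fix k assume k: "k \<in> {..<m}"
        show "z k \<otimes> h k \<in> b k" unfolding bk[OF k] l_coset_def using PiE_mem[OF h(1) k] by blast
      qed
    qed
    then show ?thesis using haar(5)[OF z(2) haar(4)[OF openbox[of "\<lambda>_. H"]]] H(1) by simp
  qed
  have "inj_on (\<lambda>c. PiE {..<m} c) ?C"
    using nonempty common by (intro inj_onI) metis
  then have cardP: "card P = card (rcosets H) ^ m"
    unfolding P_def by (simp add: card_image card_PiE)
  have "prob (PiE {..<m} c) = 1 / real (card P)"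
  proof (rule measure_equal_partition)
    show "finite P" unfolding P_def using fin by (intro finite_imageI finite_PiE) auto
    show "P \<subseteq> sets \<nu>"
      unfolding P_def
    proof (rule image_subsetI)
      fix b assume b: "b \<in> ?C"
      have "openin T (b k)" if "k < m" for k using that by (intro open_coset PiE_mem[OF b]) simp
      then show "PiE {..<m} b \<in> sets \<nu>" by (rule haar(4)[OF openbox])
    qed
    show "disjoint P"
    proof (rule disjointI)
      fix A B assume AB: "A \<in> P" "B \<in> P" "A \<noteq> B"
      obtain b b' where b: "b \<in> ?C" "A = PiE {..<m} b" and b': "b' \<in> ?C" "B = PiE {..<m} b'"
        using AB(1,2) unfolding P_def by (elim imageE) simp
      have False if "z \<in> A" "z \<in> B" for z
      proof -
        have "b = b'" by (rule common[OF b(1) b'(1) that(1)[unfolded b(2)] that(2)[unfolded b'(2)]])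
        then show False using AB(3) b(2) b'(2) by simp
      qed
      then show "A \<inter> B = {}" by (intro equals0I) (elim IntE)
    qed
    show "\<Union>P = space \<nu>"
    proof (intro equalityI subsetI)
      fix z assume "z \<in> \<Union>P"
      then obtain b where b: "b \<in> ?C" "z \<in> PiE {..<m} b" unfolding P_def by blast
      have "PiE {..<m} b \<subseteq> space \<nu>"
      proof -
        have "openin T (b k)" if "k < m" for k using that by (intro open_coset PiE_mem[OF b(1)]) simp
        then have "openin (power_topology T m) (PiE {..<m} b)" by (rule openbox)
        then show ?thesis unfolding haar(3) by (rule openin_subset)
      qed
      then show "z \<in> space \<nu>" using b by blast
    next
      fix z assume "z \<in> space \<nu>"
      then have z: "z \<in> PiE {..<m} (\<lambda>_. carrier G)" using haar(3) by simp
      let ?b = "\<lambda>k\<in>{..<m}. H #> z k"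
      have "?b \<in> ?C" using PiE_mem[OF z] subset by (intro PiE_I) (auto simp: RCOSETS_def)
      moreover have "z \<in> PiE {..<m} ?b"
        using PiE_mem[OF z] PiE_arb[OF z] rcos_self[OF _ subgroup_axioms] by (intro PiE_I) auto
      ultimately show "z \<in> \<Union>P" unfolding P_def by blast
    qed
    show "prob A = prob B" if "A \<in> P" "B \<in> P" for A B
      using that eqH unfolding P_def by (elim imageE) simp
    show "PiE {..<m} c \<in> P" unfolding P_def using c by blast
  qed
  then show ?thesis using cardP by simp
qed

text \<open>
  The preimage of a coset is a union of boxes of cosets: whether \<open>\<Phi>(z)\<close> lies in \<open>H #> g\<close> depends only
  on the class of \<open>z\<close> modulo \<open>H\<close>, and these classes solve the same equation in \<open>G Mod H\<close>.
\<close>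

lemma (in topological_group) haar_measure_commutator_preimage:
  assumes "normalized_haar_measure (power_group G (2 * n)) (power_topology T (2 * n)) \<nu>"
    and H: "openin T H" "H \<lhd> G" and fin: "finite (rcosets H)" and g: "g \<in> carrier G"
  shows "measure \<nu> (commutator_map G n -` (H #> g) \<inter> space \<nu>) =
    real (card {c \<in> PiE {..<2 * n} (\<lambda>_. carrier (G Mod H)). commutator_map (G Mod H) n c = H #> g})
      / real (order (G Mod H)) ^ (2 * n)"
proof -
  note haar = normalized_haar_measureD[OF assms(1)]
  interpret prob_space \<nu> by (rule haar(1))
  interpret normal H G by (rule H(2))
  have Q: "carrier (G Mod H) = rcosets H" by (simp add: FactGroup_def)
  define C where "C = {c \<in> PiE {..<2 * n} (\<lambda>_. rcosets H). commutator_map (G Mod H) n c = H #> g}"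
  have finC: "finite C" unfolding C_def using fin by (intro finite_subset[OF _ finite_PiE[of "{..<2 * n}"]]) auto
  have quot: "c = (\<lambda>k\<in>{..<2 * n}. H #> z k) \<and> commutator_map (G Mod H) n c = H #> commutator_map G n z"
    if c: "c \<in> PiE {..<2 * n} (\<lambda>_. rcosets H)" and z: "z \<in> PiE {..<2 * n} c" for c z
  proof -
    have zk: "z k \<in> carrier G \<and> c k = H #> z k" if k: "k \<in> {..<2 * n}" for k
    proof -
      obtain x where x: "x \<in> carrier G" "c k = H #> x" using PiE_mem[OF c k] by (auto simp: RCOSETS_def)
      then have "z k \<in> H #> x" using PiE_mem[OF z k] by simp
      then show ?thesis using x repr_independence[OF _ x(1) subgroup_axioms] r_coset_subset_G[OF subset x(1)] by auto
    qed
    then have "c = (\<lambda>k\<in>{..<2 * n}. H #> z k)" using PiE_arb[OF c] by (intro ext) (auto simp: restrict_def)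
    moreover have "commutator_map (G Mod H) n c = commutator_map (G Mod H) n (\<lambda>k. H #> z k)"
      using zk by (intro commutator_map_cong) auto
    moreover have "\<dots> = H #> commutator_map G n z"
      using zk by (intro commutator_map_quotient H(2)) auto
    ultimately show ?thesis by simp
  qed
  have "commutator_map G n -` (H #> g) \<inter> space \<nu> = (\<Union>c\<in>C. PiE {..<2 * n} c)"
  proof (intro equalityI subsetI)
    fix z assume z: "z \<in> commutator_map G n -` (H #> g) \<inter> space \<nu>"
    then have zP: "z \<in> PiE {..<2 * n} (\<lambda>_. carrier G)" using haar(3) by simp
    let ?c = "\<lambda>k\<in>{..<2 * n}. H #> z k"
    have c: "?c \<in> PiE {..<2 * n} (\<lambda>_. rcosets H)"
      using PiE_mem[OF zP] subset by (intro PiE_I) (auto simp: RCOSETS_def)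
    have zc: "z \<in> PiE {..<2 * n} ?c"
      using PiE_mem[OF zP] PiE_arb[OF zP] rcos_self[OF _ subgroup_axioms] by (intro PiE_I) auto
    have "H #> commutator_map G n z = H #> g"
      using z repr_independence[OF _ g subgroup_axioms, of "commutator_map G n z"] by simp
    then have "?c \<in> C" unfolding C_def using c quot[OF c zc] by simp
    then show "z \<in> (\<Union>c\<in>C. PiE {..<2 * n} c)" using zc by blast
  next
    fix z assume "z \<in> (\<Union>c\<in>C. PiE {..<2 * n} c)"
    then obtain c where c: "c \<in> PiE {..<2 * n} (\<lambda>_. rcosets H)" "commutator_map (G Mod H) n c = H #> g"
      "z \<in> PiE {..<2 * n} c" unfolding C_def by blast
    have zk: "z k \<in> carrier G" if k: "k \<in> {..<2 * n}" for k
    proof -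
      have "c k \<subseteq> carrier G" using PiE_mem[OF c(1) k] rcosets_part_G[OF subgroup_axioms] by blast
      then show ?thesis using PiE_mem[OF c(3) k] by blast
    qed
    then have "z \<in> PiE {..<2 * n} (\<lambda>_. carrier G)" using PiE_arb[OF c(3)] by (intro PiE_I)
    moreover have "commutator_map G n z \<in> carrier G" using zk by (intro commutator_map_closed is_group) auto
    then have "commutator_map G n z \<in> H #> commutator_map G n z" using rcos_self[OF _ subgroup_axioms] by blast
    ultimately show "z \<in> commutator_map G n -` (H #> g) \<inter> space \<nu>"
      using haar(3) quot[OF c(1,3)] c(2) by simp
  qed
  moreover have "prob (\<Union>c\<in>C. PiE {..<2 * n} c) = (\<Sum>c\<in>C. prob (PiE {..<2 * n} c))"
  proof (rule finite_measure_finite_Union[OF finC])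
    have "openin T (c k)" if "c \<in> C" "k < 2 * n" for c k
    proof -
      have "c k \<in> rcosets H" using that unfolding C_def by auto
      then show ?thesis using open_right_translate[OF H(1)] by (auto simp: RCOSETS_def)
    qed
    then show "PiE {..<2 * n} ` C \<subseteq> sets \<nu>" using haar(4) by (auto simp: openin_PiE)
    show "disjoint_family_on (PiE {..<2 * n}) C"
      unfolding disjoint_family_on_def
    proof (intro ballI impI)
      fix c c' assume "c \<in> C" "c' \<in> C" "c \<noteq> c'"
      then show "PiE {..<2 * n} c \<inter> PiE {..<2 * n} c' = {}"
        using quot[of c] quot[of c'] unfolding C_def by (metis (no_types, lifting) disjoint_iff mem_Collect_eq)
    qed
  qed
  moreover have "(\<Sum>c\<in>C. prob (PiE {..<2 * n} c)) = (\<Sum>c\<in>C. 1 / real (card (rcosets H)) ^ (2 * n))"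
    using haar_measure_coset_box[OF assms(1) H fin] by (intro sum.cong refl) (simp add: C_def)
  ultimately show ?thesis unfolding Q order_def C_def by simp
qed

section \<open>The distribution of the commutator map on cosets\<close>

lemma (in topological_group) continuous_map_commutator_map:
  assumes "k \<le> n"
  shows "continuous_map (power_topology T (2 * n)) T (commutator_map G k)"
  using assms
proof (induction k)
  case 0
  then show ?case by simp
next
  case (Suc k)
  let ?P = "power_topology T (2 * n)"
  have mult: "continuous_map ?P T (\<lambda>z. f z \<otimes> g z)" if "continuous_map ?P T f" "continuous_map ?P T g" for f g
    using continuous_map_compose[OF _ continuous_mult, of ?P "\<lambda>z. (f z, g z)"] that
    by (simp add: continuous_map_paired o_def)
  have inv: "continuous_map ?P T (\<lambda>z. inv (f z))" if "continuous_map ?P T f" for f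
    using continuous_map_compose[OF that continuous_inv] by (simp add: o_def)
  have proj: "continuous_map ?P T (\<lambda>z. z i)" if "i < 2 * n" for i
    using that by (intro continuous_map_product_projection) simp
  show ?case
    unfolding commutator_map.simps group_commutator_def
    using Suc by (intro mult inv proj) auto
qed

lemma character_continuous_map:
  fixes G (structure)
  assumes "group G" "topspace T = carrier G" "\<psi> \<in> Irr G T"
  shows "continuous_map T euclidean \<psi>"
proof -
  obtain d \<rho> where \<rho>: "continuous_representation G T d \<rho>"
    and \<psi>: "\<psi> = (\<lambda>g\<in>carrier G. mat_trace (\<rho> g))" using IrrE[OF assms(3)] .
  have "continuous_map T euclidean (\<lambda>g. \<Sum>i<d. \<rho> g $$ (i, i))"
    using continuous_representationD(4)[OF assms(1) \<rho>] by (intro continuous_map_sum) auto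
  then show ?thesis
    by (rule continuous_map_eq) (simp add: assms(2) character_eq_sum_diag[OF assms(1) \<rho> \<psi>])
qed

locale chain_with_haar = profinite_chain +
  fixes n :: nat and \<mu> :: "'a measure" and \<mu>2n :: "(nat \<Rightarrow> 'a) measure"
  assumes n_pos: "n > 0" and haar: "normalized_haar_measure G T \<mu>"
    and haar2n: "normalized_haar_measure (power_group G (2 * n)) (power_topology T (2 * n)) \<mu>2n"
begin

lemmas \<mu>_props = normalized_haar_measureD[OF haar]
lemmas \<mu>2n_props = normalized_haar_measureD[OF haar2n]

sublocale \<mu>: prob_space \<mu> by (rule \<mu>_props(1))
sublocale \<mu>2n: prob_space \<mu>2n by (rule \<mu>2n_props(1))

abbreviation quotient_order :: "nat \<Rightarrow> real" where
  "quotient_order i \<equiv> real (order (G Mod N i))"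

abbreviation commutator_distribution :: "'a measure" where
  "commutator_distribution \<equiv> distr \<mu>2n \<mu> (commutator_map G n)"

lemma rcosets_N: "carrier (G Mod N i) = rcosets (N i)"
  by (simp add: FactGroup_def)

lemma finite_rcosets_N: "finite (rcosets (N i))"
  using finite_quotient[of i] by (simp only: rcosets_N)

lemma quotient_order_pos: "quotient_order i > 0"
  using finite_quotient monoid.order_gt_0_iff_finite[OF group.is_monoid[OF normal.factorgroup_is_group[OF normal_N]]] by simp

lemma coset_in_sets: "g \<in> carrier G \<Longrightarrow> N i #> g \<in> sets \<mu>"
  using \<mu>_props(4) open_right_translate[OF open_N] by blast

lemma measure_coset: "g \<in> carrier G \<Longrightarrow> measure \<mu> (N i #> g) = 1 / quotient_order i"
  using haar_measure_coset[OF haar open_N normal_N finite_rcosets_N, of "N i #> g" i]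
    rcosetsI[OF subgroup.subset[OF subgroup_N]] by (simp add: order_def rcosets_N)

lemma coset_N_one: "N i #> \<one> = N i"
  by (rule coset_mult_one[OF subgroup.subset[OF subgroup_N]])

lemma commutator_map_measurable: "commutator_map G n \<in> measurable \<mu>2n \<mu>"
proof (rule measurable_sigma_sets[OF \<mu>_props(2)])
  note cont = continuous_map_commutator_map[OF order_refl, of n]
  show "{U. openin T U} \<subseteq> Pow (topspace T)" using openin_subset[of T] by blast
  show "commutator_map G n \<in> space \<mu>2n \<rightarrow> topspace T"
    using cont by (auto simp: \<mu>2n_props(3) continuous_map_def simp del: topspace_product_topology)
  fix U assume "U \<in> {U. openin T U}"
  then have "openin (power_topology T (2 * n)) {z \<in> topspace (power_topology T (2 * n)). commutator_map G n z \<in> U}"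
    using openin_continuous_map_preimage[OF cont] by blast
  moreover have "commutator_map G n -` U \<inter> space \<mu>2n =
      {z \<in> topspace (power_topology T (2 * n)). commutator_map G n z \<in> U}"
    unfolding \<mu>2n_props(3) by blast
  ultimately show "commutator_map G n -` U \<inter> space \<mu>2n \<in> sets \<mu>2n" using \<mu>2n_props(4) by simp
qed

lemma measure_commutator_distribution:
  "A \<in> sets \<mu> \<Longrightarrow> measure commutator_distribution A = measure \<mu>2n (commutator_map G n -` A \<inter> space \<mu>2n)"
  by (rule measure_distr[OF commutator_map_measurable])

sublocale distribution: prob_space commutator_distribution
  by (rule \<mu>2n.prob_space_distr[OF commutator_map_measurable])

definition density_term :: "'a \<Rightarrow> ('a \<Rightarrow> complex) \<Rightarrow> complex" where
  "density_term g \<psi> = \<psi> g / \<psi> \<one> ^ (2 * n - 1)"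

text \<open>
  The ratio of the two measures on the coset of \<open>N i\<close> that contains \<open>g\<close>, whose Haar measure is
  \<open>1 / quotient_order i\<close>: a mean density.
\<close>

definition level_density :: "nat \<Rightarrow> 'a \<Rightarrow> real" where
  "level_density i g = quotient_order i * measure commutator_distribution (N i #> g)"

text \<open>
  Frobenius' formula in \<open>G Mod N i\<close>, with the characters of the quotient inflated to \<open>G\<close>.
\<close>

lemma level_density_eq_sum:
  assumes g: "g \<in> carrier G"
  shows "of_real (level_density i g) = (\<Sum>\<psi>\<in>Irr_level i. density_term g \<psi>)"
proof -
  let ?Q = "G Mod N i"
  let ?I = "Irr ?Q (discrete_topology (carrier ?Q))"
  let ?pull = "\<lambda>\<psi>. \<lambda>g\<in>carrier G. \<psi> (N i #> g)"
  have Q: "group ?Q" by (rule normal.factorgroup_is_group[OF normal_N])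
  have gQ: "N i #> g \<in> carrier ?Q" using g by (auto simp: carrier_FactGroup)
  have "of_real (level_density i g) = of_real (quotient_order i) *
      (of_nat (card {c \<in> PiE {..<2 * n} (\<lambda>_. carrier ?Q). commutator_map ?Q n c = N i #> g})
        / of_nat (order ?Q) ^ (2 * n) :: complex)"
    unfolding level_density_def measure_commutator_distribution[OF coset_in_sets[OF g]]
      haar_measure_commutator_preimage[OF haar2n open_N normal_N finite_rcosets_N g] by simp
  also have "\<dots> = (\<Sum>\<psi>\<in>?I. \<psi> (N i #> g) / \<psi> \<one>\<^bsub>?Q\<^esub> ^ (2 * n - 1))"
    unfolding frobenius_commutator_count[OF Q finite_quotient gQ n_pos]
    using quotient_order_pos[of i] n_pos power_Suc[of "of_nat (order ?Q) :: complex" "2 * n - 1"]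
    by (simp del: one_FactGroup power_Suc)
  also have "\<dots> = (\<Sum>\<psi>\<in>?I. density_term g (?pull \<psi>))"
    using g coset_N_one by (intro sum.cong refl) (simp add: density_term_def)
  also have "\<dots> = (\<Sum>\<psi>\<in>?pull ` ?I. density_term g \<psi>)"
  proof (rule sum.reindex[symmetric, unfolded o_def])
    show "inj_on ?pull ?I"
    proof (rule inj_onI)
      fix \<phi> \<psi> assume \<phi>: "\<phi> \<in> ?I" and \<psi>: "\<psi> \<in> ?I" and eq: "?pull \<phi> = ?pull \<psi>"
      have "\<phi> c = \<psi> c" if "c \<in> carrier ?Q" for c
      proof -
        obtain h where h: "h \<in> carrier G" "c = N i #> h" using \<open>c \<in> carrier ?Q\<close> by (auto simp: carrier_FactGroup)
        then show ?thesis using fun_cong[OF eq, of h] by simp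
      qed
      moreover have "\<phi> \<in> extensional (carrier ?Q)" "\<psi> \<in> extensional (carrier ?Q)"
        using \<phi> \<psi> unfolding Irr_def by auto
      ultimately show "\<phi> = \<psi>" by (intro extensionalityI)
    qed
  qed
  finally show ?thesis unfolding Irr_level_eq_pullback .
qed

lemma level_density_nonneg: "level_density i g \<ge> 0"
  unfolding level_density_def by simp

text \<open>
  The degree \<open>\<psi>(1)\<close> as a real number, raised to the power \<open>2 - 2n\<close>: the term of the series at the
  identity, which dominates the terms at all other points.
\<close>

definition weight :: "('a \<Rightarrow> complex) \<Rightarrow> real" where
  "weight \<psi> = norm (\<psi> \<one>) powi (2 - 2 * int n)"

lemma weight_nonneg: "weight \<psi> \<ge> 0"
  unfolding weight_def by simp

lemma Irr_one: "\<psi> \<in> Irr G T \<Longrightarrow> \<psi> \<one> = of_real (norm (\<psi> \<one>)) \<and> norm (\<psi> \<one>) > 0"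
  by (erule Irr_degree[OF is_group]) simp

lemma weight_eq_quotient:
  assumes "\<psi> \<in> Irr G T" shows "weight \<psi> = norm (\<psi> \<one>) / norm (\<psi> \<one>) ^ (2 * n - 1)"
proof -
  have "norm (\<psi> \<one>) powi (2 - 2 * int n) = norm (\<psi> \<one>) powi (1 - int (2 * n - 1))"
    using n_pos by (simp add: of_nat_diff)
  also have "\<dots> = norm (\<psi> \<one>) / norm (\<psi> \<one>) ^ (2 * n - 1)"
    using Irr_one[OF assms] by (subst power_int_diff) auto
  finally show ?thesis unfolding weight_def .
qed

lemma norm_density_term_le:
  assumes "\<psi> \<in> Irr G T" "g \<in> carrier G"
  shows "norm (density_term g \<psi>) \<le> weight \<psi>"
  unfolding density_term_def weight_eq_quotient[OF assms(1)] norm_divide norm_power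
  using norm_character_le[OF assms] by (intro divide_right_mono) auto

lemma density_term_one:
  assumes "\<psi> \<in> Irr G T" shows "density_term \<one> \<psi> = of_real (weight \<psi>)"
  unfolding density_term_def weight_eq_quotient[OF assms] using Irr_one[OF assms] by simp

lemma summable_iff_weight_summable:
  "(\<lambda>\<psi>. \<psi> \<one> powi (2 - 2 * int n)) summable_on Irr G T \<longleftrightarrow> weight summable_on Irr G T"
proof -
  have "(\<lambda>\<psi>. \<psi> \<one> powi (2 - 2 * int n)) summable_on Irr G T \<longleftrightarrow>
      (\<lambda>\<psi>. norm (\<psi> \<one> powi (2 - 2 * int n))) summable_on Irr G T"
    by (rule summable_on_iff_abs_summable_on_complex)
  also have "\<dots> \<longleftrightarrow> weight summable_on Irr G T"
    by (intro summable_on_cong) (simp add: weight_def norm_power_int)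
  finally show ?thesis .
qed

lemma level_subset_Irr: "Irr_level i \<subseteq> Irr G T"
  unfolding Irr_eq_Union_levels by (rule UN_upper) simp

lemma level_density_one: "level_density i \<one> = (\<Sum>\<psi>\<in>Irr_level i. weight \<psi>)"
proof -
  have "of_real (level_density i \<one>) = (\<Sum>\<psi>\<in>Irr_level i. of_real (weight \<psi>) :: complex)"
    unfolding level_density_eq_sum[OF one_closed]
    using level_subset_Irr by (intro sum.cong refl density_term_one) blast
  then show ?thesis by (simp only: of_real_sum[symmetric] of_real_eq_iff)
qed

text \<open>
  At the identity the mean density is the partial sum of the positive series \<open>\<Sum> weight \<psi>\<close> over a
  level, and every finite set of irreducible characters lies in a level.
\<close>

lemma bounded_iff_summable:
  "(\<exists>C :: real. \<forall>i. measure \<mu>2n (commutator_map G n -` N i \<inter> space \<mu>2n) \<le> C * measure \<mu> (N i))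
    \<longleftrightarrow> (\<lambda>\<psi>. \<psi> \<one> powi (2 - 2 * int n)) summable_on Irr G T"
proof -
  have ineq: "measure \<mu>2n (commutator_map G n -` N i \<inter> space \<mu>2n) \<le> C * measure \<mu> (N i)
      \<longleftrightarrow> (\<Sum>\<psi>\<in>Irr_level i. weight \<psi>) \<le> C" for i C
    using measure_coset[OF one_closed, of i] coset_in_sets[OF one_closed, of i] quotient_order_pos[of i]
      measure_commutator_distribution[of "N i"]
    unfolding level_density_one[symmetric] level_density_def coset_N_one by (simp add: pos_le_divide_eq mult.commute)
  show ?thesis
    unfolding summable_iff_weight_summable ineq
  proof
    assume "\<exists>C. \<forall>i. (\<Sum>\<psi>\<in>Irr_level i. weight \<psi>) \<le> C"
    then obtain C where C: "\<And>i. (\<Sum>\<psi>\<in>Irr_level i. weight \<psi>) \<le> C" by blast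
    have "sum weight F \<le> C" if F: "F \<subseteq> Irr G T" "finite F" for F
    proof -
      obtain i where "F \<subseteq> Irr_level i" using finite_subset_Irr_level[OF F(2,1)] .
      then have "sum weight F \<le> sum weight (Irr_level i)"
        by (intro sum_mono2 finite_Irr_level weight_nonneg)
      then show ?thesis using C[of i] by linarith
    qed
    then show "weight summable_on Irr G T"
      by (intro nonneg_bdd_above_summable_on weight_nonneg bdd_aboveI[of _ C]) auto
  next
    assume sum: "weight summable_on Irr G T"
    have "(\<Sum>\<psi>\<in>Irr_level i. weight \<psi>) \<le> infsum weight (Irr G T)" for i
      by (rule finite_sum_le_infsum[OF sum finite_Irr_level level_subset_Irr weight_nonneg])
    then show "\<exists>C. \<forall>i. (\<Sum>\<psi>\<in>Irr_level i. weight \<psi>) \<le> C" by blast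
  qed
qed

lemma continuous_map_real_bounded:
  assumes "continuous_map T euclideanreal f"
  obtains B where "\<And>x. x \<in> carrier G \<Longrightarrow> \<bar>f x\<bar> \<le> B"
proof -
  have "compactin T (topspace T)" using compact by (simp add: compact_space_def)
  from image_compactin[OF this assms] have "compact (f ` carrier G)" by simp
  then have "bounded (f ` carrier G)" by (rule compact_imp_bounded)
  then obtain B where "\<forall>y\<in>f ` carrier G. norm y \<le> B" unfolding bounded_iff by blast
  then show ?thesis using that[of B] by simp
qed

lemma continuous_map_real_measurable:
  assumes "continuous_map T euclideanreal f"
  shows "f \<in> borel_measurable \<mu>"
proof (rule borel_measurableI)
  fix S :: "real set" assume "open S"
  then have "openin T {x \<in> topspace T. f x \<in> S}"
    using openin_continuous_map_preimage[OF assms] by simp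
  moreover have "f -` S \<inter> space \<mu> = {x \<in> topspace T. f x \<in> S}" unfolding \<mu>_props(3) by blast
  ultimately show "f -` S \<inter> space \<mu> \<in> sets \<mu>" using \<mu>_props(4) by simp
qed

lemma continuous_map_real_integrable:
  assumes "continuous_map T euclideanreal f"
  shows "integrable \<mu> f"
proof -
  obtain B where "\<And>x. x \<in> carrier G \<Longrightarrow> \<bar>f x\<bar> \<le> B" using continuous_map_real_bounded[OF assms] by blast
  then show ?thesis
    using \<mu>_props(3) by (intro \<mu>.integrable_const_bound[of _ B] AE_I2 continuous_map_real_measurable[OF assms]) auto
qed

lemma continuous_density_imp_bounded:
  assumes "continuous_density T commutator_distribution \<mu> f"
  shows "\<exists>C :: real. \<forall>i. measure \<mu>2n (commutator_map G n -` N i \<inter> space \<mu>2n) \<le> C * measure \<mu> (N i)"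
proof -
  have cont: "continuous_map T euclideanreal f" and nonneg: "\<And>x. x \<in> topspace T \<Longrightarrow> 0 \<le> f x"
    and dens: "commutator_distribution = density \<mu> (\<lambda>x. ennreal (f x))"
    using assms unfolding continuous_density_def by auto
  obtain B where B: "\<And>x. x \<in> carrier G \<Longrightarrow> \<bar>f x\<bar> \<le> B" using continuous_map_real_bounded[OF cont] by blast
  have B0: "B \<ge> 0" using B[OF one_closed] by linarith
  have "measure \<mu>2n (commutator_map G n -` N i \<inter> space \<mu>2n) \<le> B * measure \<mu> (N i)" for i
  proof -
    have Ni: "N i \<in> sets \<mu>" using \<mu>_props(4)[OF open_N] .
    have "emeasure commutator_distribution (N i) = (\<integral>\<^sup>+x. ennreal (f x) * indicator (N i) x \<partial>\<mu>)"
      unfolding dens using continuous_map_real_measurable[OF cont] Ni by (intro emeasure_density) auto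
    also have "\<dots> \<le> (\<integral>\<^sup>+x. ennreal B * indicator (N i) x \<partial>\<mu>)"
    proof (intro nn_integral_mono mult_right_mono ennreal_leI)
      fix x assume "x \<in> space \<mu>"
      then have "x \<in> carrier G" using \<mu>_props(3) by simp
      then show "f x \<le> B" using B[of x] by linarith
    qed simp
    also have "\<dots> = ennreal B * emeasure \<mu> (N i)" using Ni by (rule nn_integral_cmult_indicator)
    finally have "ennreal (measure commutator_distribution (N i)) \<le> ennreal (B * measure \<mu> (N i))"
      unfolding distribution.emeasure_eq_measure \<mu>.emeasure_eq_measure using B0 by (simp add: ennreal_mult)
    then show ?thesis using B0 measure_commutator_distribution[OF Ni] by (simp add: ennreal_le_iff)
  qed
  then show ?thesis by blast
qed

section \<open>The density as the sum of the character series\<close>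

text \<open>
  As in a tree, two cosets of members of the chain are either disjoint or nested. So the cosets,
  with the empty set, are stable under intersection and can serve as a generator on which finite
  measures are compared.
\<close>

lemma cosets_nested:
  assumes ij: "i \<le> j" and gh: "g \<in> carrier G" "h \<in> carrier G" and meet: "(N i #> g) \<inter> (N j #> h) \<noteq> {}"
  shows "N j #> h \<subseteq> N i #> g"
proof -
  obtain x where x: "x \<in> N i #> g" "x \<in> N j #> h" using meet by blast
  have "N i #> g = N i #> x" "N j #> h = N j #> x"
    using repr_independence[OF x(1) gh(1) subgroup_N] repr_independence[OF x(2) gh(2) subgroup_N] by auto
  moreover have "N j #> x \<subseteq> N i #> x" using decseqD[OF decseq_N ij] by (auto simp: r_coset_def)
  ultimately show ?thesis by simp
qed

definition cosets :: "'a set set" where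
  "cosets = insert {} (\<Union>i. rcosets (N i))"

lemma cosetsE:
  assumes "A \<in> cosets"
  obtains "A = {}" | i g where "g \<in> carrier G" "A = N i #> g"
  using assms unfolding cosets_def RCOSETS_def by blast

lemma coset_in_cosets: "g \<in> carrier G \<Longrightarrow> N i #> g \<in> cosets"
  unfolding cosets_def RCOSETS_def by blast

lemma cosets_subset_open: "cosets \<subseteq> {U. openin T U}"
proof
  fix A assume "A \<in> cosets"
  then show "A \<in> {U. openin T U}"
    by (cases rule: cosetsE) (simp_all add: open_right_translate[OF open_N])
qed

lemma Int_stable_cosets: "Int_stable cosets"
proof (rule Int_stableI)
  fix A B assume A: "A \<in> cosets" and B: "B \<in> cosets"
  show "A \<inter> B \<in> cosets"
  proof (cases "A \<inter> B = {}")
    case True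
    then show ?thesis by (simp add: cosets_def)
  next
    case False
    obtain i g where g: "g \<in> carrier G" "A = N i #> g" using A False by (cases rule: cosetsE) auto
    obtain j h where h: "h \<in> carrier G" "B = N j #> h" using B False by (cases rule: cosetsE) auto
    have "B \<subseteq> A \<or> A \<subseteq> B"
    proof (cases "i \<le> j")
      case True
      then show ?thesis using cosets_nested[OF True g(1) h(1)] False g h by simp
    next
      case neg: False
      then have "j \<le> i" by simp
      from cosets_nested[OF this h(1) g(1)] show ?thesis using False g h by (simp add: Int_commute)
    qed
    then have "A \<inter> B = B \<or> A \<inter> B = A" by blast
    then show ?thesis using A B by presburger
  qed
qed

text \<open>
  There are only countably many cosets, as each \<open>N i\<close> has finite index, and every open set is the
  union of those that it contains.
\<close>

lemma sets_eq_sigma_cosets: "sets \<mu> = sigma_sets (carrier G) cosets"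
proof -
  have "countable cosets"
    unfolding cosets_def by (intro countable_insert countable_UN countableI_type countable_finite finite_rcosets_N)
  have "sigma_sets (carrier G) {U. openin T U} = sigma_sets (carrier G) cosets"
  proof (rule sigma_sets_eqI)
    fix U assume "U \<in> {U. openin T U}"
    then have U: "openin T U" by simp
    then have "U \<subseteq> carrier G" using openin_subset[OF U] by simp
    have "\<Union>{A \<in> cosets. A \<subseteq> U} \<in> sigma_sets (carrier G) cosets"
      using \<open>countable cosets\<close> by (intro sigma_sets_UNION) (auto intro: countable_subset)
    moreover have "\<Union>{A \<in> cosets. A \<subseteq> U} = U"
    proof (intro equalityI subsetI)
      fix x assume x: "x \<in> U"
      obtain i where "N i #> x \<subseteq> U" using chain_neighbourhood_basis[OF U x] .
      moreover have "x \<in> carrier G" using x \<open>U \<subseteq> carrier G\<close> by blast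
      ultimately show "x \<in> \<Union>{A \<in> cosets. A \<subseteq> U}"
        using coset_in_cosets[of x i] rcos_self[OF _ subgroup_N] by blast
    qed blast
    ultimately show "U \<in> sigma_sets (carrier G) cosets" by simp
  next
    fix A assume "A \<in> cosets"
    then show "A \<in> sigma_sets (carrier G) {U. openin T U}" using cosets_subset_open by blast
  qed
  then show ?thesis using \<mu>_props(2) by simp
qed

lemma measure_eq_if_cosets_agree:
  assumes "sets M = sets \<mu>" "finite_measure M"
    and agree: "\<And>i g. g \<in> carrier G \<Longrightarrow> emeasure M (N i #> g) = emeasure commutator_distribution (N i #> g)"
  shows "commutator_distribution = M"
proof (rule measure_eqI_generator_eq_countable[OF Int_stable_cosets])
  interpret M: finite_measure M by fact
  show "cosets \<subseteq> Pow (carrier G)"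
  proof
    fix A assume "A \<in> cosets"
    then have "openin T A" using cosets_subset_open by blast
    then show "A \<in> Pow (carrier G)" using openin_subset[of T A] by simp
  qed
  show "emeasure commutator_distribution A = emeasure M A" if "A \<in> cosets" for A
    using that agree by (cases rule: cosetsE) simp_all
  show "sets commutator_distribution = sigma_sets (carrier G) cosets"
    "sets M = sigma_sets (carrier G) cosets"
    using sets_eq_sigma_cosets assms(1) by simp_all
  show "rcosets (N 0) \<subseteq> cosets" unfolding cosets_def by blast
  show "\<Union>(rcosets (N 0)) = carrier G" by (rule rcosets_part_G[OF subgroup_N])
  show "countable (rcosets (N 0))" using finite_rcosets_N by (rule countable_finite)
  show "emeasure commutator_distribution A \<noteq> \<infinity>" for A by simp
qed

lemma level_density_continuous: "continuous_map T euclideanreal (level_density i)"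
proof -
  have "continuous_map T euclideanreal (\<lambda>g. Re (\<Sum>\<psi>\<in>Irr_level i. density_term g \<psi>))"
  proof -
    have "continuous_map T euclidean (\<lambda>g. \<Sum>\<psi>\<in>Irr_level i. density_term g \<psi>)"
    proof (intro continuous_map_sum finite_Irr_level)
      fix \<psi> assume "\<psi> \<in> Irr_level i"
      then have "\<psi> \<in> Irr G T" using level_subset_Irr by blast
      then have "continuous_map T euclidean \<psi>"
        by (rule character_continuous_map[OF is_group topspace_eq])
      then have "continuous_map T euclidean (\<lambda>g. \<psi> g * inverse (\<psi> \<one> ^ (2 * n - 1)))"
        by (intro continuous_map_normed_algebra_mult) simp_all
      then show "continuous_map T euclidean (\<lambda>g. density_term g \<psi>)"
        by (simp add: density_term_def divide_inverse)
    qed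
    moreover have "continuous_map euclidean euclideanreal Re"
      by (simp add: continuous_on_Re)
    ultimately have "continuous_map T euclideanreal (Re \<circ> (\<lambda>g. \<Sum>\<psi>\<in>Irr_level i. density_term g \<psi>))"
      by (rule continuous_map_compose)
    then show ?thesis by (simp only: o_def)
  qed
  then show ?thesis
  proof (rule continuous_map_eq)
    fix g assume "g \<in> topspace T"
    then have "g \<in> carrier G" by simp
    from level_density_eq_sum[OF this, of i, symmetric]
    show "Re (\<Sum>\<psi>\<in>Irr_level i. density_term g \<psi>) = level_density i g" by simp
  qed
qed

lemma level_density_coset:
  assumes "g \<in> carrier G" "x \<in> N i #> g"
  shows "level_density i x = level_density i g"
  using repr_independence[OF assms(2,1) subgroup_N] unfolding level_density_def by simp

lemma coset_union_of_deeper: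
  assumes ij: "i \<le> j" and g: "g \<in> carrier G"
  shows "\<Union>{c \<in> rcosets (N j). c \<subseteq> N i #> g} = N i #> g"
proof (intro equalityI subsetI)
  fix x assume x: "x \<in> N i #> g"
  have xc: "x \<in> carrier G" using x r_coset_subset_G[OF subgroup.subset[OF subgroup_N] g] by blast
  have xx: "x \<in> N j #> x" by (rule rcos_self[OF xc subgroup_N])
  then have "N j #> x \<subseteq> N i #> g" using x by (intro cosets_nested[OF ij g xc]) blast
  then show "x \<in> \<Union>{c \<in> rcosets (N j). c \<subseteq> N i #> g}"
    using xx rcosetsI[OF subgroup.subset[OF subgroup_N] xc] by blast
qed blast

lemma set_integrable_continuous:
  assumes "continuous_map T euclideanreal f" "A \<in> sets \<mu>"
  shows "set_integrable \<mu> A f"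
  unfolding set_integrable_def
  using integrable_mult_indicator[OF assms(2) continuous_map_real_integrable[OF assms(1)]] .

text \<open>
  A coset of \<open>N i\<close> is a finite disjoint union of cosets of the deeper \<open>N j\<close>, on each of which the
  mean density at level \<open>j\<close> is constant and has the right integral by definition.
\<close>

lemma integral_level_density_coset:
  assumes ij: "i \<le> j" and g: "g \<in> carrier G"
  shows "(LINT x:N i #> g|\<mu>. level_density j x) = measure commutator_distribution (N i #> g)"
proof -
  define D where "D = {c \<in> rcosets (N j). c \<subseteq> N i #> g}"
  have D: "\<Union>D = N i #> g" unfolding D_def by (rule coset_union_of_deeper[OF ij g])
  have fin: "finite D" unfolding D_def using finite_rcosets_N by simp
  have disj: "disjoint_family_on (\<lambda>c. c) D"
    unfolding disjoint_family_on_def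
  proof (intro ballI impI)
    fix c c' assume "c \<in> D" "c' \<in> D" "c \<noteq> c'"
    then show "c \<inter> c' = {}"
      using pairwiseD[OF rcos_disjoint[OF subgroup_N], of c j c'] unfolding D_def disjnt_def by simp
  qed
  have repr: "\<exists>h\<in>carrier G. c = N j #> h" if "c \<in> D" for c
    using that unfolding D_def RCOSETS_def by blast
  have sets: "c \<in> sets \<mu>" if "c \<in> D" for c using repr[OF that] coset_in_sets by blast
  have "(LINT x:N i #> g|\<mu>. level_density j x) = (LINT x:(\<Union>c\<in>D. c)|\<mu>. level_density j x)"
    using D by simp
  also have "\<dots> = (\<Sum>c\<in>D. LINT x:c|\<mu>. level_density j x)"
    by (intro set_integral_finite_Union fin disj set_integrable_continuous level_density_continuous sets)
  also have "\<dots> = (\<Sum>c\<in>D. measure commutator_distribution c)"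
  proof (intro sum.cong refl)
    fix c assume c: "c \<in> D"
    obtain h where h: "h \<in> carrier G" "c = N j #> h" using repr[OF c] by blast
    have "(LINT x:c|\<mu>. level_density j x) = (LINT x:c|\<mu>. level_density j h)"
      using sets[OF c] level_density_coset[OF h(1)] h(2) by (intro set_lebesgue_integral_cong) auto
    also have "\<dots> = measure \<mu> c * level_density j h"
      using sets[OF c] by (simp add: set_lebesgue_integral_def)
    also have "\<dots> = measure commutator_distribution c"
      using measure_coset[OF h(1), of j] quotient_order_pos[of j] by (simp add: level_density_def h(2))
    finally show "(LINT x:c|\<mu>. level_density j x) = measure commutator_distribution c" .
  qed
  also have "\<dots> = measure commutator_distribution (\<Union>c\<in>D. c)"
    using distribution.finite_measure_finite_Union[OF fin _ disj] sets by (simp add: subset_iff image_def)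
  finally show ?thesis using D by simp
qed

definition series_density :: "'a \<Rightarrow> real" where
  "series_density g = Re (infsum (density_term g) (Irr G T))"

lemma level_density_tendsto:
  assumes sum: "weight summable_on Irr G T" and g: "g \<in> carrier G"
  shows "(density_term g has_sum of_real (series_density g)) (Irr G T)"
    and "(\<lambda>i. level_density i g) \<longlonglongrightarrow> series_density g"
proof -
  have "(\<lambda>\<psi>. norm (density_term g \<psi>)) summable_on Irr G T"
    using norm_density_term_le[OF _ g] by (intro Infinite_Sum.abs_summable_on_comparison_test'[OF sum])
  then have has: "(density_term g has_sum infsum (density_term g) (Irr G T)) (Irr G T)"
    by (rule has_sum_infsum[OF abs_summable_summable])
  then have "(sum (density_term g) \<longlongrightarrow> infsum (density_term g) (Irr G T)) (finite_subsets_at_top (Irr G T))"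
    unfolding has_sum_def .
  from filterlim_compose[OF this Irr_level_filterlim]
  have lim: "(\<lambda>i. of_real (level_density i g)) \<longlonglongrightarrow> infsum (density_term g) (Irr G T)"
    by (simp add: level_density_eq_sum[OF g])
  from tendsto_Re[OF this] show "(\<lambda>i. level_density i g) \<longlonglongrightarrow> series_density g"
    by (simp add: series_density_def)
  then have "(\<lambda>i. of_real (level_density i g) :: complex) \<longlonglongrightarrow> of_real (series_density g)"
    by (rule tendsto_of_real)
  from LIMSEQ_unique[OF lim this] has
  show "(density_term g has_sum of_real (series_density g)) (Irr G T)" by simp
qed

text \<open>
  The error is bounded by the tail of the dominating series \<open>\<Sum> weight \<psi>\<close>, which does not depend on
  \<open>g\<close>.
\<close>

lemma level_density_uniform_error:
  assumes sum: "weight summable_on Irr G T" and g: "g \<in> carrier G"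
  shows "\<bar>series_density g - level_density i g\<bar> \<le> infsum weight (Irr G T) - sum weight (Irr_level i)"
proof -
  have "((\<lambda>\<psi>. density_term g \<psi>) has_sum (of_real (series_density g) - of_real (level_density i g))) (Irr G T - Irr_level i)"
    unfolding level_density_eq_sum[OF g]
    by (intro has_sum_Diff level_density_tendsto(1)[OF sum g] has_sum_finite finite_Irr_level level_subset_Irr)
  moreover have "(weight has_sum (infsum weight (Irr G T) - sum weight (Irr_level i))) (Irr G T - Irr_level i)"
    by (intro has_sum_Diff has_sum_infsum sum has_sum_finite finite_Irr_level level_subset_Irr)
  ultimately have "norm (of_real (series_density g) - of_real (level_density i g) :: complex) \<le>
      infsum weight (Irr G T) - sum weight (Irr_level i)"
    by (rule norm_infsum_le) (rule norm_density_term_le[OF _ g], erule DiffD1)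
  then show ?thesis by (simp flip: of_real_diff)
qed

lemma level_density_uniform_limit:
  assumes sum: "weight summable_on Irr G T" and e: "e > 0"
  shows "\<forall>\<^sub>F i in sequentially. \<forall>g\<in>carrier G. \<bar>series_density g - level_density i g\<bar> < e"
proof -
  have "(sum weight \<longlongrightarrow> infsum weight (Irr G T)) (finite_subsets_at_top (Irr G T))"
    using has_sum_infsum[OF sum] unfolding has_sum_def .
  from filterlim_compose[OF this Irr_level_filterlim]
  have "(\<lambda>i. sum weight (Irr_level i)) \<longlonglongrightarrow> infsum weight (Irr G T)" .
  then have "\<forall>\<^sub>F i in sequentially. dist (sum weight (Irr_level i)) (infsum weight (Irr G T)) < e"
    using e by (rule tendstoD)
  then show ?thesis
  proof eventually_elim
    case (elim i)
    then have bound: "infsum weight (Irr G T) - sum weight (Irr_level i) < e" by (simp add: dist_real_def)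
    show ?case using order_le_less_trans[OF level_density_uniform_error[OF sum] bound] by blast
  qed
qed

lemma series_density_nonneg:
  assumes "weight summable_on Irr G T" "g \<in> carrier G"
  shows "series_density g \<ge> 0"
  by (rule LIMSEQ_le_const[OF level_density_tendsto(2)[OF assms]]) (simp add: level_density_nonneg)

lemma series_density_continuous:
  assumes sum: "weight summable_on Irr G T"
  shows "continuous_map T euclideanreal series_density"
proof -
  have "continuous_map T Met_TC.mtopology series_density"
  proof (rule Met_TC.continuous_map_uniform_limit[of T level_density sequentially])
    show "\<forall>\<^sub>F i in sequentially. continuous_map T Met_TC.mtopology (level_density i)"
      using level_density_continuous by simp
    show "\<forall>\<^sub>F i in sequentially. \<forall>x\<in>topspace T. series_density x \<in> UNIV \<and> dist (level_density i x) (series_density x) < e"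
      if "e > 0" for e :: real
      using level_density_uniform_limit[OF sum that] by eventually_elim (simp add: dist_real_def abs_minus_commute)
  qed simp
  then show ?thesis by simp
qed

text \<open>
  The integrals of the mean densities over a fixed coset do not depend on the level, once it is
  deep enough; the uniform limit inherits their common value.
\<close>

lemma series_density_integral_coset:
  assumes sum: "weight summable_on Irr G T" and g: "g \<in> carrier G"
  shows "(LINT x:N i #> g|\<mu>. series_density x) = measure commutator_distribution (N i #> g)"
proof -
  let ?c = "N i #> g"
  note cont = series_density_continuous[OF sum]
  have "\<bar>(LINT x:?c|\<mu>. series_density x) - measure commutator_distribution ?c\<bar> \<le> e" if "e > 0" for e
  proof -
    have "\<forall>\<^sub>F j in sequentially. i \<le> j \<and> (\<forall>x\<in>carrier G. \<bar>series_density x - level_density j x\<bar> < e)"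
      using level_density_uniform_limit[OF sum \<open>e > 0\<close>] eventually_ge_at_top[of i] by eventually_elim simp
    then obtain j where j: "i \<le> j" "\<And>x. x \<in> carrier G \<Longrightarrow> \<bar>series_density x - level_density j x\<bar> < e"
      unfolding eventually_sequentially by blast
    have int: "set_integrable \<mu> ?c series_density" "set_integrable \<mu> ?c (level_density j)"
      by (intro set_integrable_continuous cont level_density_continuous coset_in_sets g)+
    have "(LINT x:?c|\<mu>. series_density x) - measure commutator_distribution ?c =
        (LINT x:?c|\<mu>. series_density x - level_density j x)"
      using set_integral_diff(2)[OF int] integral_level_density_coset[OF j(1) g] by simp
    also have "norm \<dots> \<le> (LINT x|\<mu>. e)"
      unfolding set_lebesgue_integral_def
    proof (rule order_trans[OF Bochner_Integration.integral_norm_bound Bochner_Integration.integral_mono])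
      show "integrable \<mu> (\<lambda>x. norm (indicat_real ?c x *\<^sub>R (series_density x - level_density j x)))"
        using set_integral_diff(1)[OF int] unfolding set_integrable_def by (rule integrable_norm)
      fix x assume "x \<in> space \<mu>"
      then have "\<bar>series_density x - level_density j x\<bar> \<le> e" using j(2)[of x] \<mu>_props(3) by simp
      then show "norm (indicat_real ?c x *\<^sub>R (series_density x - level_density j x)) \<le> e"
        using \<open>e > 0\<close> by (simp add: indicator_def)
    qed simp
    finally show ?thesis using \<mu>.prob_space by simp
  qed
  then have "\<bar>(LINT x:?c|\<mu>. series_density x) - measure commutator_distribution ?c\<bar> \<le> 0"
    by (rule field_le_epsilon[of _ 0, simplified])
  then show ?thesis by simp
qed

lemma summable_imp_series_density:
  assumes sum: "weight summable_on Irr G T"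
  shows "continuous_density T commutator_distribution \<mu> series_density"
proof -
  note cont = series_density_continuous[OF sum]
  have nonneg: "0 \<le> series_density x" if "x \<in> topspace T" for x
    using series_density_nonneg[OF sum] that by simp
  let ?M = "density \<mu> (\<lambda>x. ennreal (series_density x))"
  have meas: "(\<lambda>x. ennreal (series_density x)) \<in> borel_measurable \<mu>"
    using continuous_map_real_measurable[OF cont] by simp
  have emeasure_M: "emeasure ?M A = ennreal (LINT x:A|\<mu>. series_density x)" if A: "A \<in> sets \<mu>" for A
  proof -
    have "emeasure ?M A = (\<integral>\<^sup>+x. ennreal (series_density x) * indicator A x \<partial>\<mu>)"
      by (rule emeasure_density[OF meas A])
    also have "\<dots> = (\<integral>\<^sup>+x. ennreal (indicator A x *\<^sub>R series_density x) \<partial>\<mu>)"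
      by (intro nn_integral_cong) (simp add: indicator_def)
    also have "\<dots> = ennreal (LINT x:A|\<mu>. series_density x)"
      unfolding set_lebesgue_integral_def
    proof (rule nn_integral_eq_integral)
      show "integrable \<mu> (\<lambda>x. indicator A x *\<^sub>R series_density x)"
        using set_integrable_continuous[OF cont A] unfolding set_integrable_def .
      show "AE x in \<mu>. 0 \<le> indicat_real A x *\<^sub>R series_density x"
        using nonneg \<mu>_props(3) by (intro AE_I2) (simp add: indicator_def)
    qed
    finally show ?thesis .
  qed
  have "commutator_distribution = ?M"
  proof (rule measure_eq_if_cosets_agree)
    show "finite_measure ?M"
    proof
      show "emeasure ?M (space ?M) \<noteq> \<infinity>" using emeasure_M[OF sets.top] by simp
    qed
    show "emeasure ?M (N i #> g) = emeasure commutator_distribution (N i #> g)" if g: "g \<in> carrier G" for i g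
      unfolding emeasure_M[OF coset_in_sets[OF g]] series_density_integral_coset[OF sum g]
      by (simp add: distribution.emeasure_eq_measure)
  qed simp
  then show ?thesis using cont nonneg unfolding continuous_density_def by blast
qed

end

theorem propositionI:
  fixes G :: "('a, 'b) monoid_scheme" (structure)
    and T :: "'a topology"
    and N :: "nat \<Rightarrow> 'a set"
    and n :: nat
    and \<mu> :: "'a measure"
    and \<mu>2n :: "(nat \<Rightarrow> 'a) measure"
  assumes "profinite_group G T"
    and "topologically_finitely_generated G T"
    and "\<And>i. openin T (N i)"
    and "\<And>i. N i \<lhd> G"
    and "decseq N"
    and "(\<Inter>i. N i) = {\<one>}"
    and "n \<ge> 2"
    and "normalized_haar_measure G T \<mu>"
    and "normalized_haar_measure (power_group G (2 * n)) (power_topology T (2 * n)) \<mu>2n"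
  shows "((\<exists>f. continuous_density T (distr \<mu>2n \<mu> (commutator_map G n)) \<mu> f)
           \<longleftrightarrow> (\<exists>C :: real. \<forall>i. measure \<mu>2n (commutator_map G n -` N i \<inter> space \<mu>2n)
                  \<le> C * measure \<mu> (N i)))
       \<and> ((\<exists>C :: real. \<forall>i. measure \<mu>2n (commutator_map G n -` N i \<inter> space \<mu>2n)
                  \<le> C * measure \<mu> (N i))
           \<longleftrightarrow> (\<lambda>\<psi>. \<psi> \<one> powi (2 - 2 * int n)) summable_on Irr G T)
       \<and> ((\<exists>f. continuous_density T (distr \<mu>2n \<mu> (commutator_map G n)) \<mu> f)
           \<longrightarrow> (\<exists>f. continuous_density T (distr \<mu>2n \<mu> (commutator_map G n)) \<mu> f
                 \<and> (\<forall>g \<in> carrier G.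
                      ((\<lambda>\<psi>. \<psi> g / \<psi> \<one> ^ (2 * n - 1)) has_sum of_real (f g)) (Irr G T))))"
proof -
  interpret chain_with_haar G T N n \<mu> \<mu>2n
    using assms by (intro chain_with_haar.intro chain_with_haar_axioms.intro
        profinite_chain.intro profinite_chain_axioms.intro) auto
  let ?density = "continuous_density T commutator_distribution \<mu>"
  let ?bounded = "\<exists>C :: real. \<forall>i. measure \<mu>2n (commutator_map G n -` N i \<inter> space \<mu>2n) \<le> C * measure \<mu> (N i)"
  let ?summable = "(\<lambda>\<psi>. \<psi> \<one> powi (2 - 2 * int n)) summable_on Irr G T"
  have bounded_if_density: "?density f \<Longrightarrow> ?bounded" for f
    by (rule continuous_density_imp_bounded)
  have density_if_summable: "?density series_density" and
    formula: "\<forall>g\<in>carrier G. ((\<lambda>\<psi>. \<psi> g / \<psi> \<one> ^ (2 * n - 1)) has_sum of_real (series_density g)) (Irr G T)"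
    if ?summable
    using that summable_imp_series_density level_density_tendsto(1)
    unfolding summable_iff_weight_summable density_term_def by blast+
  show ?thesis
    using bounded_if_density bounded_iff_summable density_if_summable formula by blast
qed

end
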